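(* Let $0<q<1$, $r\ge 1$, $\vec n=(n_1,\dots,n_r)\in\mathbb{N}^r$ (with $0\in\mathbb N$), and $|\vec n|=n_1+\cdots+n_r$. Let $\vec a=(a_1,\dots,a_r)$ and $b,c,d$ be parameters with $|a_j|,|b|,|c|,|d|<1$, $b\neq 0$, $a_j=q^{\alpha_j}$ (so $a_j\ne 0$), and $\alpha_i-\alpha_j\notin\mathbb{Z}$ for $i\ne j$ (meaning that $a_i/a_j$ is not an integer power of $q$ for $i\neq j$). Then the multiple Askey--Wilson polynomial $p_{\vec n}(x;\vec a,b,c,d|q)$ for the weights $w(\theta;a_1,b,c,d|q),\dots,w(\theta;a_r,b,c,d|q)$ is given by $$p_{\vec n}(x;\vec a,b,c,d|q)=T_{b,c,d}\,q_{\vec n}\left(x;\tfrac{b}{q}\vec a,\tfrac{cd}{q}\,\middle|\,q\right),$$ that is, the polynomial on the right-hand side has degree $|\vec n|$ and satisfies $$\int_{-1}^1 p_{\vec n}(x;\vec a,b,c,d|q)\,x^\ell\, w(\theta;a_j,b,c,d|q)\,\frac{dx}{\sqrt{1-x^2}}=0,\qquad 0\le \ell\le n_j-1,\ 1\le j\le r,\quad x=\cos\theta .$$ Moreover, with $x=\cos\theta$ and $|\vec k|=k_1+\cdots+k_r$, it has the explicit expression $$p_{\vec n}(x;\vec a,b,c,d|q)=\sum_{k_1=0}^{n_1}\cdots\sum_{k_r=0}^{n_r}\ \prod_{j=1}^r\frac{(q^{-n_j};q)_{k_j}\,(a_jbcd\,q^{\sum_{i=1}^j n_i-1};q)_{\sum_{i=j}^r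 k_i}}{(q;q)_{k_j}\,(a_jb;q)_{\sum_{i=j}^r k_i}}\ \prod_{j=1}^{r-1}\frac{(a_jbq^{n_j};q)_{k_{j+1}+\cdots+k_r}}{(a_jbcd\,q^{\sum_{i=1}^j n_i-1};q)_{k_{j+1}+\cdots+k_r}}\ \frac{q^{|\vec k|}}{q^{\sum_{j=1}^r n_j\sum_{i=j+1}^r k_i}}\ \frac{(be^{i\theta},be^{-i\theta};q)_{|\vec k|}}{(bc;q)_{|\vec k|}(bd;q)_{|\vec k|}} .$$
   Context: Notation: $(z;q)_k=\prod_{j=0}^{k-1}(1-zq^j)$, $(z;q)_\infty=\prod_{j\ge0}(1-zq^j)$, $(z_1,\dots,z_m;q)_k=\prod_i (z_i;q)_k$ (also for $k=\infty$). Askey--Wilson weight ($x=\cos\theta$): $$w(\theta;a,b,c,d|q)=\frac{(e^{2i\theta},e^{-2i\theta};q)_\infty}{(ae^{i\theta},ae^{-i\theta},be^{i\theta},be^{-i\theta},ce^{i\theta},ce^{-i\theta},de^{i\theta},de^{-i\theta};q)_\infty}.$$ $T_{b,c,d}$ is the linear map on polynomials in $x$ determined by $T_{b,c,d}(x^k)=\dfrac{(be^{i\theta},be^{-i\theta};q)_k}{(bc;q)_k(bd;q)_k}$, where $(be^{i\theta},be^{-i\theta};q)_k=\prod_{j=0}^{k-1}(1+b^2q^{2j}-2bq^jx)$ is a polynomial in $x=\cos\theta$. Multiple little $q$-Jacobi polynomials (of the first kind): for $\vec A=(A_1,\dots,A_r)$ and $B$ with $0<|A_jq|<1$, $|Bq|<1$,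 and $A_i/A_j$ not an integer power of $q$ for $i\ne j$, $q_{\vec n}(x;\vec A,B|q)$ is the polynomial of degree $|\vec n|$, normalized by $q_{\vec n}(0;\vec A,B|q)=1$, which satisfies $$\sum_{k=0}^\infty q_{\vec n}(q^k;\vec A,B|q)\,q^{k\ell}\,(A_jq)^k\frac{(Bq;q)_k}{(q;q)_k}=0,\qquad 0\le\ell\le n_j-1,\ 1\le j\le r;$$ these conditions determine it uniquely. Here $\frac bq\vec a=(\frac{a_1b}{q},\dots,\frac{a_rb}{q})$. The multiple (type II) Askey--Wilson polynomial for $\vec n$ is the polynomial of degree $|\vec n|$ satisfying the displayed integral orthogonality conditions; under the stated assumptions these determine it uniquely up to a multiplicative constant. Convention: in the explicit sum, for $1\le j\le r-1$ the quotient $(X_j;q)_{\sum_{i=j}^r k_i}/(X_j;q)_{\sum_{i=j+1}^r k_i}$ with $X_j=a_jbcd\,q^{\sum_{i=1}^j n_i-1}$ is understood as $(X_jq^{\sum_{i=j+1}^rk_i};q)_{k_j}$ (relevant only if the denominator vanishes, which can occur only when $n_1=\dots=n_j=0$). *)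

theory Defs
  imports "HOL-Analysis.Analysis" "HOL-Computational_Algebra.Polynomial"
begin

text \<open>
  Vectors such as \<open>(n\<^sub>1, \<dots>, n\<^sub>r)\<close> are functions on the natural numbers,
  of which only the values at the indices \<open>1, \<dots>, r\<close> matter. The base \<open>q\<close> is real,
  all other parameters are complex.
\<close>

definition qpoch :: "complex \<Rightarrow> real \<Rightarrow> nat \<Rightarrow> complex" where
  "qpoch z q k = (\<Prod>j<k. 1 - z * of_real q ^ j)"

definition qpoch_inf :: "complex \<Rightarrow> real \<Rightarrow> complex" where
  "qpoch_inf z q = (\<Prod>j. 1 - z * of_real q ^ j)"

definition askey_wilson_weight ::
    "real \<Rightarrow> real \<Rightarrow> complex \<Rightarrow> complex \<Rightarrow> complex \<Rightarrow> complex \<Rightarrow> complex" where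
  "askey_wilson_weight q \<theta> a b c d =
     qpoch_inf (cis (2 * \<theta>)) q * qpoch_inf (cis (- (2 * \<theta>))) q /
     (qpoch_inf (a * cis \<theta>) q * qpoch_inf (a * cis (- \<theta>)) q *
      (qpoch_inf (b * cis \<theta>) q * qpoch_inf (b * cis (- \<theta>)) q) *
      (qpoch_inf (c * cis \<theta>) q * qpoch_inf (c * cis (- \<theta>)) q) *
      (qpoch_inf (d * cis \<theta>) q * qpoch_inf (d * cis (- \<theta>)) q))"

text \<open>
  With \<open>x = cos \<theta>\<close>, the polynomial below takes the value
  \<open>(b e\<^sup>i\<^sup>\<theta>, b e\<^sup>-\<^sup>i\<^sup>\<theta>; q)\<^sub>k\<close>, since
  \<open>(1 - z e\<^sup>i\<^sup>\<theta>) (1 - z e\<^sup>-\<^sup>i\<^sup>\<theta>) = 1 + z\<^sup>2 - 2 z x\<close>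
  for \<open>z = b q\<^sup>j\<close>.
\<close>

definition askey_wilson_basis :: "real \<Rightarrow> complex \<Rightarrow> nat \<Rightarrow> complex poly" where
  "askey_wilson_basis q b k =
     (\<Prod>j<k. [: 1 + b ^ 2 * of_real q ^ (2 * j), - 2 * b * of_real q ^ j :])"

definition T_op ::
    "real \<Rightarrow> complex \<Rightarrow> complex \<Rightarrow> complex \<Rightarrow> complex poly \<Rightarrow> complex poly" where
  "T_op q b c d p =
     (\<Sum>k\<le>degree p. smult (coeff p k / (qpoch (b * c) q k * qpoch (b * d) q k))
                         (askey_wilson_basis q b k))"

definition is_multiple_little_q_jacobi ::
    "real \<Rightarrow> nat \<Rightarrow> (nat \<Rightarrow> nat) \<Rightarrow> (nat \<Rightarrow> complex) \<Rightarrow> complex \<Rightarrow> complex poly \<Rightarrow> bool" where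
  "is_multiple_little_q_jacobi q r n A B p \<longleftrightarrow>
     degree p = (\<Sum>j=1..r. n j) \<and> poly p 0 = 1 \<and>
     (\<forall>j\<in>{1..r}. \<forall>l<n j.
        (\<lambda>k. poly p (of_real q ^ k) * of_real q ^ (k * l) * (A j * of_real q) ^ k *
             (qpoch (B * of_real q) q k / qpoch (of_real q) q k)) sums 0)"

definition multiple_little_q_jacobi ::
    "real \<Rightarrow> nat \<Rightarrow> (nat \<Rightarrow> nat) \<Rightarrow> (nat \<Rightarrow> complex) \<Rightarrow> complex \<Rightarrow> complex poly" where
  "multiple_little_q_jacobi q r n A B = (THE p. is_multiple_little_q_jacobi q r n A B p)"

text \<open>
  The condition \<open>p \<noteq> 0\<close> only matters if all \<open>n\<^sub>j\<close> vanish, because the library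
  assigns degree 0 to the zero polynomial. The integral condition includes integrability.
\<close>

definition is_multiple_askey_wilson ::
    "real \<Rightarrow> nat \<Rightarrow> (nat \<Rightarrow> nat) \<Rightarrow> (nat \<Rightarrow> complex) \<Rightarrow> complex \<Rightarrow> complex \<Rightarrow> complex
      \<Rightarrow> complex poly \<Rightarrow> bool" where
  "is_multiple_askey_wilson q r n a b c d p \<longleftrightarrow>
     p \<noteq> 0 \<and> degree p = (\<Sum>j=1..r. n j) \<and>
     (\<forall>j\<in>{1..r}. \<forall>l<n j.
        ((\<lambda>x. poly p (of_real x) * of_real x ^ l *
              askey_wilson_weight q (arccos x) (a j) b c d / of_real (sqrt (1 - x ^ 2)))
           has_integral 0) {-1..1})"

definition tail_sum :: "nat \<Rightarrow> (nat \<Rightarrow> nat) \<Rightarrow> nat \<Rightarrow> nat" where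
  "tail_sum r k j = (\<Sum>i=j..r. k i)"

definition X_param ::
    "real \<Rightarrow> (nat \<Rightarrow> nat) \<Rightarrow> (nat \<Rightarrow> complex) \<Rightarrow> complex \<Rightarrow> complex \<Rightarrow> complex \<Rightarrow> nat \<Rightarrow> complex" where
  "X_param q n a b c d j =
     a j * b * c * d * of_real q powi (int (\<Sum>i=1..j. n i) - 1)"

text \<open>
  One term of the explicit sum. For \<open>j < r\<close> the quotient
  \<open>(X\<^sub>j; q)\<^sub>K / (X\<^sub>j; q)\<^sub>L\<close>, where \<open>K = k\<^sub>j + \<dots> + k\<^sub>r\<close> and
  \<open>L = k\<^sub>j\<^sub>+\<^sub>1 + \<dots> + k\<^sub>r\<close>, is written as \<open>(X\<^sub>j q\<^sup>L; q)\<close> with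
  subscript \<open>k\<^sub>j\<close>. This avoids the quotient \<open>0 / 0\<close>, which occurs in the first form
  if \<open>a\<^sub>j b c d = q\<close>, \<open>n\<^sub>1 = \<dots> = n\<^sub>j = 0\<close> and \<open>L > 0\<close>. For \<open>j = r\<close>
  there is no denominator.
\<close>

definition explicit_term ::
    "real \<Rightarrow> nat \<Rightarrow> (nat \<Rightarrow> nat) \<Rightarrow> (nat \<Rightarrow> complex) \<Rightarrow> complex \<Rightarrow> complex \<Rightarrow> complex
      \<Rightarrow> real \<Rightarrow> (nat \<Rightarrow> nat) \<Rightarrow> complex" where
  "explicit_term q r n a b c d \<theta> k =
     (\<Prod>j=1..r. qpoch (of_real q powi (- int (n j))) q (k j) /
                (qpoch (of_real q) q (k j) * qpoch (a j * b) q (tail_sum r k j))) *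
     qpoch (X_param q n a b c d r) q (k r) *
     (\<Prod>j=1..r-1. qpoch (X_param q n a b c d j * of_real q ^ tail_sum r k (j + 1)) q (k j) *
                  qpoch (a j * b * of_real q ^ n j) q (tail_sum r k (j + 1))) *
     (of_real q ^ tail_sum r k 1 / of_real q ^ (\<Sum>j=1..r. n j * tail_sum r k (j + 1))) *
     (qpoch (b * cis \<theta>) q (tail_sum r k 1) * qpoch (b * cis (- \<theta>)) q (tail_sum r k 1) /
      (qpoch (b * c) q (tail_sum r k 1) * qpoch (b * d) q (tail_sum r k 1)))"

end

theory Submission
  imports Defs "HOL-Complex_Analysis.Complex_Analysis"
begin

text \<open>
  Write \<open>(z)\<^sub>k\<close> for \<open>(z; q)\<^sub>k\<close>, and put \<open>\<beta> = c d\<close> and \<open>t\<^sub>j = a\<^sub>j b\<close>. The theorem holds because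
  both families of orthogonality conditions are expressed by one linear map, the
  ratio transform \<open>\<Lambda>\<close>, which sends \<open>x\<^sup>m\<close> to the function \<open>(y)\<^sub>m / (\<beta> y)\<^sub>m\<close> of \<open>y\<close>.

  On the little q-Jacobi side, the series \<open>\<phi>(y) = \<Sum>\<^sub>k (\<beta>)\<^sub>k / (q)\<^sub>k y\<^sup>k\<close> satisfies
  \<open>(1 - y) \<phi>(y) = (1 - \<beta> y) \<phi>(q y)\<close>, so that
  \<open>\<Sum>\<^sub>k p(q\<^sup>k) y\<^sup>k (\<beta>)\<^sub>k / (q)\<^sub>k = \<phi>(y) \<Lambda>(p)(y)\<close> with \<open>\<phi>(y) \<noteq> 0\<close>. The conditions on \<open>p\<close> thus say
  that \<open>\<Lambda>(p)\<close> vanishes at the nodes \<open>t\<^sub>j q\<^sup>l\<close> with \<open>l < n\<^sub>j\<close>.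

  On the Askey--Wilson side, multiplying the weight by \<open>(b e\<^sup>i\<^sup>\<theta>, b e\<^sup>-\<^sup>i\<^sup>\<theta>)\<^sub>m\<close> replaces \<open>b\<close> by \<open>b q\<^sup>m\<close>,
  and multiplying it by \<open>(a\<^sub>j e\<^sup>i\<^sup>\<theta>, a\<^sub>j e\<^sup>-\<^sup>i\<^sup>\<theta>)\<^sub>l\<close> replaces \<open>a\<^sub>j\<close> by \<open>a\<^sub>j q\<^sup>l\<close>. Replacing \<open>b\<close> by \<open>b q\<^sup>m\<close>
  multiplies the total mass of the weight by
  \<open>(a b)\<^sub>m (b c)\<^sub>m (b d)\<^sub>m / (a b c d)\<^sub>m\<close>. The denominators in the definition of \<open>T\<close> cancel
  \<open>(b c)\<^sub>m (b d)\<^sub>m\<close>, and hence the integral of \<open>T p\<close> against \<open>(a\<^sub>j e\<^sup>i\<^sup>\<theta>, a\<^sub>j e\<^sup>-\<^sup>i\<^sup>\<theta>)\<^sub>l\<close> is a multiple of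
  \<open>\<Lambda>(p)(t\<^sub>j q\<^sup>l)\<close> (lemma \<open>has_integral_T_op_basis\<close>). The behaviour of the mass follows from a first-moment
  identity for the weight, which is Cauchy's theorem on an annulus applied to a function
  that changes sign under \<open>z \<mapsto> 1 / (q z)\<close> (lemmas \<open>integral_aw_shift_kernel\<close> and
  \<open>aw_integral_contiguous\<close>).

  The multiple little q-Jacobi polynomial is characterized by its zeros in this sense: if \<open>p\<close> has degree
  \<open>M\<close>, then \<open>(\<beta> y)\<^sub>M \<Lambda>(p)(y)\<close> is a polynomial in \<open>y\<close> of degree at most \<open>M\<close>, which determines
  \<open>p\<close>; if it vanishes at more than \<open>M\<close> nodes, then \<open>p = 0\<close> (lemma \<open>ratio_transform_eq_0_imp_eq_0\<close>).
  For the explicit expression, \<open>\<Lambda>\<close> of the multiple sum is evaluated from the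
  inside. The sum over \<open>k\<^sub>1\<close> is a q-Pfaff--Saalschuetz sum; it produces the factor
  \<open>\<Prod>\<^sub>i (y - t\<^sub>1 q\<^sup>i)\<close>, with \<open>i < n\<^sub>1\<close>, and leaves the same kind of sum over \<open>k\<^sub>2, \<dots>, k\<^sub>r\<close> with
  \<open>\<beta>\<close> replaced by \<open>\<beta> q\<^sup>N\<close>, where \<open>N = n\<^sub>1\<close>. So all the nodes are zeros (lemmas \<open>multiple_jacobi_innermost_sum\<close>,
  \<open>multiple_jacobi_tail_sum_vanishes\<close>).
\<close>

section \<open>Shifted factorials\<close>

lemma norm_mult_less_1:
  fixes x y :: "'a::real_normed_field"
  assumes "norm x < 1" "norm y < 1"
  shows "norm (x * y) < 1"
proof -
  have "norm x * norm y \<le> norm x * 1"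
    using assms(2) by (intro mult_left_mono) auto
  thus ?thesis
    using assms(1) by (simp add: norm_mult)
qed

locale q_base =
  fixes q :: real
  assumes q_pos: "0 < q" and q_less_1: "q < 1"
begin

lemma q_nonzero [simp]: "q \<noteq> 0"
  using q_pos by simp

lemma norm_q_power_le_1: "norm (complex_of_real q ^ k) \<le> 1"
  using q_pos q_less_1 by (simp add: norm_power power_le_one)

lemma norm_mult_q_power_less_1: "norm z < 1 \<Longrightarrow> norm (z * complex_of_real q ^ k) < 1"
  by (metis norm_mult mult_left_le norm_ge_zero norm_q_power_le_1 le_less_trans)

lemma one_minus_nonzero: "norm z < 1 \<Longrightarrow> 1 - z \<noteq> (0::complex)"
  by auto

lemma qpoch_0 [simp]: "qpoch z q 0 = 1"
  by (simp add: qpoch_def)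

lemma qpoch_Suc: "qpoch z q (Suc k) = qpoch z q k * (1 - z * of_real q ^ k)"
  by (simp add: qpoch_def)

lemma qpoch_add: "qpoch z q (m + k) = qpoch z q m * qpoch (z * of_real q ^ m) q k"
  by (induction k) (simp_all add: qpoch_Suc power_add mult_ac)

lemma qpoch_Suc_left: "qpoch z q (Suc k) = (1 - z) * qpoch (z * of_real q) q k"
  using qpoch_add[of z 1 k] by (simp add: qpoch_def)

lemma qpoch_nonzero: "norm z < 1 \<Longrightarrow> qpoch z q k \<noteq> 0"
  using norm_mult_q_power_less_1 one_minus_nonzero by (force simp: qpoch_def)

lemma qpoch_q_nonzero: "qpoch (of_real q) q k \<noteq> 0"
  using q_pos q_less_1 by (intro qpoch_nonzero) simp

lemma qpoch_inverse_power_eq_0: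
  assumes "m < k"
  shows "qpoch (inverse (of_real q ^ m)) q k = 0"
  using assms by (auto simp: qpoch_def intro!: bexI[of _ m])

lemma convergent_qpoch_inf: "convergent_prod (\<lambda>j. 1 - z * complex_of_real q ^ j)"
proof -
  have "summable (\<lambda>j. norm z * q ^ j)"
    using q_pos q_less_1 by (intro summable_mult summable_geometric) simp
  hence "summable (\<lambda>j. norm ((1 - z * complex_of_real q ^ j) - 1))"
    using q_pos by (simp add: norm_mult norm_power)
  thus ?thesis
    by (metis abs_convergent_prod_conv_summable abs_convergent_prod_imp_convergent_prod)
qed

lemma qpoch_inf_split: "qpoch_inf z q = qpoch z q k * qpoch_inf (z * of_real q ^ k) q"
proof -
  have "qpoch_inf z q = (\<Prod>j<k. 1 - z * of_real q ^ j) * (\<Prod>j. 1 - z * of_real q ^ (j + k))"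
    unfolding qpoch_inf_def
    by (rule has_prod_unique[symmetric])
       (rule has_prod_ignore_initial_segment'[OF convergent_qpoch_inf])
  thus ?thesis
    by (simp add: qpoch_def qpoch_inf_def power_add mult_ac)
qed

lemma qpoch_inf_unfold: "qpoch_inf z q = (1 - z) * qpoch_inf (z * of_real q) q"
  using qpoch_inf_split[of z 1] by (simp add: qpoch_def)

lemma qpoch_inf_nonzero:
  assumes "norm z < 1"
  shows "qpoch_inf z q \<noteq> 0"
  unfolding qpoch_inf_def
  using norm_mult_q_power_less_1[OF assms] one_minus_nonzero
  by (intro prodinf_nonzero convergent_qpoch_inf) blast

text \<open>
  The partial products converge uniformly on discs by the Weierstrass test, since
  \<open>\<bar>z q\<^sup>j\<bar> \<le> (\<bar>w\<bar> + 1) q\<^sup>j\<close> there. This makes the infinite product an entire function of \<open>z\<close>.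
\<close>

lemma uniform_limit_qpoch_inf:
  "uniform_limit (cball w 1) (\<lambda>k z. qpoch z q k) (\<lambda>z. qpoch_inf z q) sequentially"
proof -
  have "uniformly_convergent_on (cball w 1)
          (\<lambda>N z. \<Sum>j<N. norm ((1 - z * complex_of_real q ^ j) - 1))"
  proof (rule Weierstrass_m_test')
    show "norm (norm ((1 - z * complex_of_real q ^ j) - 1)) \<le> (norm w + 1) * q ^ j"
      if "z \<in> cball w 1" for j z
    proof -
      have "norm z \<le> norm w + 1"
        using that norm_triangle_ineq2[of z w] by (simp add: dist_norm norm_minus_commute)
      thus ?thesis
        using q_pos by (simp add: norm_mult norm_power mult_right_mono)
    qed
    show "summable (\<lambda>j. (norm w + 1) * q ^ j)"
      using q_pos q_less_1 by (intro summable_mult summable_geometric) simp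
  qed
  hence "uniformly_convergent_on (cball w 1) (\<lambda>k z. qpoch z q k)"
    unfolding qpoch_def
    by (intro uniformly_convergent_on_prod' continuous_intros) auto
  hence *: "uniform_limit (cball w 1) (\<lambda>k z. qpoch z q k) (\<lambda>z. lim (\<lambda>k. qpoch z q k)) sequentially"
    by (simp add: uniformly_convergent_uniform_limit_iff)
  have "lim (\<lambda>k. qpoch z q k) = qpoch_inf z q" for z
    using convergent_prod_LIMSEQ[OF convergent_qpoch_inf[of z]]
    by (intro limI) (simp add: qpoch_def qpoch_inf_def LIMSEQ_lessThan_iff_atMost)
  with * show ?thesis by simp
qed

lemma holomorphic_qpoch_inf_UNIV: "(\<lambda>z. qpoch_inf z q) holomorphic_on UNIV"
proof (rule holomorphic_uniform_sequence)
  show "(\<lambda>z. qpoch z q k) holomorphic_on UNIV" for k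
    unfolding qpoch_def by (intro holomorphic_intros)
  show "\<exists>d>0. cball x d \<subseteq> UNIV \<and>
          uniform_limit (cball x d) (\<lambda>k z. qpoch z q k) (\<lambda>z. qpoch_inf z q) sequentially" for x
    using uniform_limit_qpoch_inf[of x] by (intro exI[of _ 1]) auto
qed auto

lemma holomorphic_qpoch_inf [holomorphic_intros]:
  assumes "f holomorphic_on S"
  shows "(\<lambda>z. qpoch_inf (f z) q) holomorphic_on S"
  using holomorphic_on_compose_gen[OF assms holomorphic_qpoch_inf_UNIV] by (simp add: o_def)

lemma continuous_on_qpoch_inf [continuous_intros]:
  assumes "continuous_on S f"
  shows "continuous_on S (\<lambda>x. qpoch_inf (f x) q)"
  using continuous_on_compose2[OF holomorphic_on_imp_continuous_on[OF holomorphic_qpoch_inf_UNIV] assms]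
  by simp

end

section \<open>The q-binomial series and the ratio transform\<close>

context q_base
begin

text \<open>
  The map \<open>\<Lambda>\<close> through which both families of orthogonality conditions factor.
\<close>

definition ratio_transform :: "complex \<Rightarrow> complex poly \<Rightarrow> complex \<Rightarrow> complex" where
  "ratio_transform \<beta> p y = (\<Sum>m\<le>degree p. coeff p m * (qpoch y q m / qpoch (\<beta> * y) q m))"


lemma ratio_transform_bound:
  assumes "degree p \<le> M"
  shows "ratio_transform \<beta> p y = (\<Sum>m\<le>M. coeff p m * (qpoch y q m / qpoch (\<beta> * y) q m))"
  unfolding ratio_transform_def
  using assms by (intro sum.mono_neutral_left) (auto simp: coeff_eq_0)

lemma ratio_transform_diff_smult:
  "ratio_transform \<beta> (smult x p - smult x' p') y =
     x * ratio_transform \<beta> p y - x' * ratio_transform \<beta> p' y"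
proof -
  let ?M = "max (degree p) (degree p')"
  have "degree (smult x p - smult x' p') \<le> ?M"
    by (intro degree_diff_le order.trans[OF degree_smult_le]) auto
  thus ?thesis
    by (simp add: ratio_transform_bound[of _ ?M] sum_subtractf sum_distrib_left right_diff_distrib
        diff_divide_distrib mult_ac)
qed

definition qbin_coeff :: "complex \<Rightarrow> nat \<Rightarrow> complex" where
  "qbin_coeff \<beta> k = qpoch \<beta> q k / qpoch (of_real q) q k"

text \<open>
  By the q-binomial theorem this is \<open>(\<beta> y; q)\<^sub>\<infinity> / (y; q)\<^sub>\<infinity>\<close>. What follows uses its functional
  equation instead of the product.
\<close>

definition qbin_series :: "complex \<Rightarrow> complex \<Rightarrow> complex" where
  "qbin_series \<beta> y = (\<Sum>k. qbin_coeff \<beta> k * y ^ k)"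

text \<open>
  The coefficients converge to \<open>(\<beta>; q)\<^sub>\<infinity> / (q; q)\<^sub>\<infinity>\<close>, so they are bounded and the series is
  dominated by a geometric one.
\<close>

lemma summable_qbin_series:
  assumes "norm y < 1"
  shows "summable (\<lambda>k. qbin_coeff \<beta> k * y ^ k)"
proof -
  have lim: "(\<lambda>k. qpoch z q k) \<longlonglongrightarrow> qpoch_inf z q" for z
    using tendsto_uniform_limitI[OF uniform_limit_qpoch_inf[of z], of z] by simp
  have "qpoch_inf (of_real q) q \<noteq> 0"
    using q_pos q_less_1 by (intro qpoch_inf_nonzero) simp
  hence "(\<lambda>k. qbin_coeff \<beta> k) \<longlonglongrightarrow> qpoch_inf \<beta> q / qpoch_inf (of_real q) q"
    unfolding qbin_coeff_def by (intro tendsto_divide lim)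
  hence "convergent (qbin_coeff \<beta>)"
    by (auto simp: convergent_def)
  then obtain K where K: "\<And>k. norm (qbin_coeff \<beta> k) \<le> K"
    using convergent_imp_Bseq BseqE by metis
  show ?thesis
  proof (rule summable_comparison_test')
    show "summable (\<lambda>k. K * norm y ^ k)"
      using assms by (intro summable_mult summable_geometric) simp
    show "norm (qbin_coeff \<beta> k * y ^ k) \<le> K * norm y ^ k" for k
      using K[of k] by (simp add: norm_mult norm_power mult_right_mono)
  qed
qed

lemma qbin_series_sums: "norm y < 1 \<Longrightarrow> (\<lambda>k. qbin_coeff \<beta> k * y ^ k) sums qbin_series \<beta> y"
  unfolding qbin_series_def by (intro summable_sums summable_qbin_series)

text \<open>
  The coefficients \<open>f\<^sub>k\<close> satisfy \<open>f\<^sub>k\<^sub>+\<^sub>1 (1 - q\<^sup>k\<^sup>+\<^sup>1) = f\<^sub>k (1 - \<beta> q\<^sup>k)\<close>. Multiplying by \<open>y\<^sup>k\<^sup>+\<^sup>1\<close> and summing over \<open>k\<close>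
  turns this into the functional equation.
\<close>

lemma qbin_series_shift:
  assumes "norm y < 1"
  shows "(1 - y) * qbin_series \<beta> y = (1 - \<beta> * y) * qbin_series \<beta> (y * of_real q)"
proof -
  let ?q = "complex_of_real q" and ?f = "qbin_coeff \<beta>"
  have yq: "norm (y * ?q) < 1"
    using norm_mult_q_power_less_1[OF assms, of 1] by simp
  have coeff: "?f (Suc k) * (1 - ?q ^ Suc k) = ?f k * (1 - \<beta> * ?q ^ k)" for k
  proof -
    have "1 - ?q ^ Suc k \<noteq> 0"
      using qpoch_q_nonzero[of "Suc k"] by (simp add: qpoch_Suc)
    thus ?thesis
      by (simp add: qbin_coeff_def qpoch_Suc)
  qed
  have *: "(\<lambda>k. ?f k * y ^ k - ?f k * (y * ?q) ^ k) sums (qbin_series \<beta> y - qbin_series \<beta> (y * ?q))"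
    by (intro sums_diff qbin_series_sums assms yq)
  have "(\<lambda>k. ?f (Suc k) * y ^ Suc k - ?f (Suc k) * (y * ?q) ^ Suc k) sums
      (qbin_series \<beta> y - qbin_series \<beta> (y * ?q))"
    using * by (subst sums_Suc_iff) simp
  moreover have "?f (Suc k) * y ^ Suc k - ?f (Suc k) * (y * ?q) ^ Suc k =
      y * (?f k * y ^ k) - \<beta> * y * (?f k * (y * ?q) ^ k)" for k
  proof -
    have "?f (Suc k) * y ^ Suc k - ?f (Suc k) * (y * ?q) ^ Suc k =
        (?f (Suc k) * (1 - ?q ^ Suc k)) * y ^ Suc k"
      by (simp only: power_mult_distrib right_diff_distrib left_diff_distrib mult_1_right mult_1_left mult_ac)
    also have "\<dots> = y * (?f k * y ^ k) - \<beta> * y * (?f k * (y * ?q) ^ k)"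
      unfolding coeff by (simp add: algebra_simps power_mult_distrib)
    finally show ?thesis .
  qed
  ultimately have "(\<lambda>k. y * (?f k * y ^ k) - \<beta> * y * (?f k * (y * ?q) ^ k)) sums
      (qbin_series \<beta> y - qbin_series \<beta> (y * ?q))"
    by simp
  moreover have "(\<lambda>k. y * (?f k * y ^ k) - \<beta> * y * (?f k * (y * ?q) ^ k)) sums
      (y * qbin_series \<beta> y - \<beta> * y * qbin_series \<beta> (y * ?q))"
    by (intro sums_diff sums_mult qbin_series_sums assms yq)
  ultimately have "qbin_series \<beta> y - qbin_series \<beta> (y * ?q) =
      y * qbin_series \<beta> y - \<beta> * y * qbin_series \<beta> (y * ?q)"
    by (rule sums_unique2)
  thus ?thesis by (simp add: algebra_simps)
qed

lemma qbin_series_shift_power: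
  assumes "norm y < 1" "norm \<beta> < 1"
  shows "qbin_series \<beta> (y * of_real q ^ m) = qbin_series \<beta> y * (qpoch y q m / qpoch (\<beta> * y) q m)"
proof (induction m)
  case (Suc m)
  let ?y = "y * of_real q ^ m"
  have y: "norm ?y < 1" by (rule norm_mult_q_power_less_1[OF assms(1)])
  hence "norm (\<beta> * ?y) < 1"
    by (rule norm_mult_less_1[OF assms(2)])
  hence "1 - \<beta> * ?y \<noteq> 0" by (rule one_minus_nonzero)
  hence "qbin_series \<beta> (y * of_real q ^ Suc m) = (1 - ?y) / (1 - \<beta> * ?y) * qbin_series \<beta> ?y"
    using qbin_series_shift[OF y, of \<beta>] by (simp add: divide_simps mult_ac)
  thus ?case
    unfolding Suc.IH by (simp add: qpoch_Suc mult_ac)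
qed simp

text \<open>
  By the functional equation, a zero at \<open>y\<close> would give zeros at all \<open>y q\<^sup>m\<close>. These points tend to
  \<open>0\<close>, where the series has the value \<open>1\<close>.
\<close>

lemma qbin_series_nonzero:
  assumes "norm y < 1" "norm \<beta> < 1"
  shows "qbin_series \<beta> y \<noteq> 0"
proof
  assume "qbin_series \<beta> y = 0"
  hence zero: "qbin_series \<beta> (y * of_real q ^ m) = 0" for m
    by (simp add: qbin_series_shift_power[OF assms])
  have "isCont (qbin_series \<beta>) 0"
    unfolding qbin_series_def
    by (rule isCont_powser[of _ "1/2"]) (auto intro: summable_qbin_series)
  moreover have "(\<lambda>m. y * of_real q ^ m) \<longlonglongrightarrow> y * 0"
    using q_pos q_less_1 by (intro tendsto_mult tendsto_const LIMSEQ_power_zero) simp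
  ultimately have "(\<lambda>m. qbin_series \<beta> (y * of_real q ^ m)) \<longlonglongrightarrow> qbin_series \<beta> 0"
    using isCont_tendsto_compose by fastforce
  hence "qbin_series \<beta> 0 = 0"
    unfolding zero by (simp add: LIMSEQ_const_iff)
  thus False
    unfolding qbin_series_def powser_zero by (simp add: qbin_coeff_def)
qed

text \<open>
  The monomial \<open>x\<^sup>m\<close> contributes \<open>\<phi>(y q\<^sup>m)\<close>, where \<open>\<phi>\<close> is the q-binomial series, and the functional equation
  rewrites this as \<open>\<phi>(y) (y)\<^sub>m / (\<beta> y)\<^sub>m\<close>.
\<close>

lemma poly_qbin_sums:
  assumes "norm y < 1" "norm \<beta> < 1"
  shows "(\<lambda>k. poly p (of_real q ^ k) * y ^ k * qbin_coeff \<beta> k) sums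
           (qbin_series \<beta> y * ratio_transform \<beta> p y)"
proof -
  have "(\<lambda>k. \<Sum>m\<le>degree p. coeff p m * (qbin_coeff \<beta> k * (y * of_real q ^ m) ^ k)) sums
      (\<Sum>m\<le>degree p. coeff p m * qbin_series \<beta> (y * of_real q ^ m))"
    by (intro sums_sum sums_mult qbin_series_sums norm_mult_q_power_less_1 assms)
  moreover have "(\<Sum>m\<le>degree p. coeff p m * (qbin_coeff \<beta> k * (y * of_real q ^ m) ^ k)) =
      poly p (of_real q ^ k) * y ^ k * qbin_coeff \<beta> k" for k
    by (simp add: poly_altdef sum_distrib_left sum_distrib_right power_mult_distrib mult_ac
          flip: power_mult)
  moreover have "(\<Sum>m\<le>degree p. coeff p m * qbin_series \<beta> (y * of_real q ^ m)) =
      qbin_series \<beta> y * ratio_transform \<beta> p y"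
    by (simp add: qbin_series_shift_power[OF assms] ratio_transform_def sum_distrib_left mult_ac)
  ultimately show ?thesis by simp
qed

end

section \<open>Uniqueness of multiple little q-Jacobi polynomials\<close>

context q_base
begin

text \<open>
  Zero counting for the ratio transform. Multiplied by \<open>(\<beta> y)\<^sub>M\<close>, where \<open>M\<close> is the degree of \<open>p\<close>, it becomes
  a polynomial \<open>R\<close> in \<open>y\<close> of degree at most \<open>M\<close>; more than \<open>M\<close> zeros force \<open>R = 0\<close>. The
  coefficients of \<open>p\<close> then vanish one after another, because the polynomials
  \<open>(y)\<^sub>k (\<beta> y q\<^sup>k)\<^sub>M\<^sub>-\<^sub>k\<close> are triangular with respect to the points \<open>q\<^sup>-\<^sup>k\<close>.
\<close>

lemma ratio_transform_eq_0_imp_eq_0: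
  assumes "norm \<beta> < 1" "finite Z" "degree p < card Z"
    and Z: "\<And>y. y \<in> Z \<Longrightarrow> norm y < 1 \<and> ratio_transform \<beta> p y = 0"
  shows "p = 0"
proof -
  let ?q = "complex_of_real q"
  define M where "M = degree p"
  define e where "e k = (\<Prod>i<k. [: 1, - (?q ^ i) :]) * (\<Prod>i=k..<M. [: 1, - (\<beta> * ?q ^ i) :])" for k
  define R where "R = (\<Sum>k\<le>M. smult (coeff p k) (e k))"
  have poly_e: "poly (e k) y = qpoch y q k * (\<Prod>i=k..<M. 1 - \<beta> * y * ?q ^ i)" for k y
    by (simp add: e_def poly_prod qpoch_def mult_ac)
  have "degree (e k) \<le> M" if "k \<le> M" for k
  proof -
    have deg: "degree (\<Prod>i\<in>A. [:1, - c i:]) \<le> card A" for c :: "nat \<Rightarrow> complex" and A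
    proof (cases "finite A")
      case True
      have "degree (\<Prod>i\<in>A. [:1, - c i:]) \<le> (\<Sum>i\<in>A. degree [:1, - c i:])"
        by (rule degree_prod_sum_le[OF True, unfolded o_def])
      also have "\<dots> \<le> (\<Sum>i\<in>A. 1)"
        by (intro sum_mono) (simp add: degree_pCons_eq_if)
      finally show ?thesis by simp
    qed simp
    have "degree (e k) \<le> card {..<k} + card {k..<M}"
      unfolding e_def
      by (intro order.trans[OF degree_mult_le] add_mono deg)
    thus ?thesis using that by simp
  qed
  hence deg_R: "degree R \<le> M"
    unfolding R_def by (intro degree_sum_le order.trans[OF degree_smult_le]) auto
  have "poly R y = 0" if "y \<in> Z" for y
  proof -
    have "norm (\<beta> * y) < 1"
      using Z[OF that] by (intro norm_mult_less_1 assms(1)) simp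
    hence nz: "qpoch (\<beta> * y) q k \<noteq> 0" for k by (rule qpoch_nonzero)
    have split: "qpoch (\<beta> * y) q M = qpoch (\<beta> * y) q k * (\<Prod>i=k..<M. 1 - \<beta> * y * ?q ^ i)"
      if "k \<le> M" for k
      using that unfolding qpoch_def lessThan_atLeast0
      by (simp add: prod.atLeastLessThan_concat)
    have "poly R y = (\<Sum>k\<le>M. coeff p k * (qpoch y q k * (\<Prod>i=k..<M. 1 - \<beta> * y * ?q ^ i)))"
      by (simp add: R_def poly_sum poly_e)
    also have "\<dots> = (\<Sum>k\<le>M. qpoch (\<beta> * y) q M * (coeff p k * (qpoch y q k / qpoch (\<beta> * y) q k)))"
      by (intro sum.cong refl) (simp add: split nz)
    also have "\<dots> = qpoch (\<beta> * y) q M * ratio_transform \<beta> p y"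
      by (simp add: ratio_transform_def M_def sum_distrib_left)
    finally show ?thesis using Z[OF that] by simp
  qed
  hence "Z \<subseteq> {y. poly R y = 0}" by auto
  have R_0: "R = 0"
  proof (rule ccontr)
    assume "R \<noteq> 0"
    hence "card Z \<le> degree R"
      using \<open>Z \<subseteq> _\<close> card_poly_roots_bound[of R] card_mono[OF poly_roots_finite[of R], of Z] by simp
    thus False using deg_R assms(3) by (simp add: M_def)
  qed
  have "coeff p k = 0" if "k \<le> M" for k
    using that
  proof (induction k rule: less_induct)
    case (less k)
    \<comment> \<open>At \<open>q\<^sup>-\<^sup>k\<close> the summands of index above \<open>k\<close> contain the factor \<open>1 - q\<^sup>-\<^sup>k q\<^sup>k\<close>; those below
       vanish by induction.\<close>
    let ?y = "inverse (?q ^ k)"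
    have "0 = (\<Sum>i\<le>M. coeff p i * poly (e i) ?y)"
      using arg_cong[OF R_0, of "\<lambda>p. poly p ?y"] by (simp add: R_def poly_sum)
    also have "\<dots> = (\<Sum>i\<in>{k}. coeff p i * poly (e i) ?y)"
    proof (rule sum.mono_neutral_right)
      show "\<forall>i\<in>{..M} - {k}. coeff p i * poly (e i) ?y = 0"
      proof
        fix i assume "i \<in> {..M} - {k}"
        hence "i < k \<or> k < i" "i \<le> M" by auto
        thus "coeff p i * poly (e i) ?y = 0"
          using less.IH[of i] by (auto simp: poly_e qpoch_inverse_power_eq_0)
      qed
    qed (use less.prems in auto)
    finally have "coeff p k * (qpoch ?y q k * (\<Prod>i=k..<M. 1 - \<beta> * ?y * ?q ^ i)) = 0"
      by (simp add: poly_e)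
    moreover have "qpoch ?y q k \<noteq> 0"
    proof -
      have "?y * ?q ^ j \<noteq> 1" if "j < k" for j
      proof
        assume "?y * ?q ^ j = 1"
        hence "?q ^ j = ?q ^ k" by (simp add: field_simps)
        hence "q ^ j = q ^ k" by (metis of_real_eq_iff of_real_power)
        thus False using that q_pos q_less_1 power_inject_exp'[of q] by (simp add: power_strict_decreasing_iff)
      qed
      thus ?thesis by (auto simp: qpoch_def)
    qed
    moreover have "1 - \<beta> * ?y * ?q ^ i \<noteq> 0" if "i \<in> {k..<M}" for i
    proof -
      have "?y * ?q ^ i = ?q ^ (i - k)"
        using that by (simp add: power_diff field_simps)
      thus ?thesis
        using one_minus_nonzero[OF norm_mult_q_power_less_1[OF assms(1), of "i - k"]]
        by (simp add: mult.assoc)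
    qed
    ultimately show ?case by simp
  qed
  hence "coeff p (degree p) = 0" by (simp add: M_def)
  thus ?thesis by simp
qed

text \<open>
  The points \<open>t\<^sub>j q\<^sup>l\<close> with \<open>l < n\<^sub>j\<close>: there is one for each orthogonality condition, and it is the point at
  which the ratio transform has to vanish.
\<close>

definition jacobi_nodes :: "nat \<Rightarrow> (nat \<Rightarrow> nat) \<Rightarrow> (nat \<Rightarrow> complex) \<Rightarrow> complex set" where
  "jacobi_nodes r n t = (\<lambda>(j, l). t j * of_real q ^ l) ` (SIGMA j:{1..r}. {..<n j})"

lemma finite_jacobi_nodes: "finite (jacobi_nodes r n t)"
  by (simp add: jacobi_nodes_def)

lemma jacobi_nodesE:
  assumes "y \<in> jacobi_nodes r n t"
  obtains j l where "j \<in> {1..r}" "l < n j" "y = t j * of_real q ^ l"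
  using assms by (auto simp: jacobi_nodes_def)

text \<open>
  Two nodes with different \<open>j\<close> differ because \<open>t\<^sub>i / t\<^sub>j\<close> is not an integer power of \<open>q\<close>. So there are as
  many nodes as conditions.
\<close>

lemma card_jacobi_nodes:
  assumes "\<And>j. j \<in> {1..r} \<Longrightarrow> t j \<noteq> 0"
    and "\<And>i j m. i \<in> {1..r} \<Longrightarrow> j \<in> {1..r} \<Longrightarrow> i \<noteq> j \<Longrightarrow> t i / t j \<noteq> of_real q powi (m :: int)"
  shows "card (jacobi_nodes r n t) = (\<Sum>j=1..r. n j)"
proof -
  let ?q = "complex_of_real q"
  have "i = j \<and> l = l'"
    if i: "i \<in> {1..r}" and j: "j \<in> {1..r}" and eq: "t i * ?q ^ l = t j * ?q ^ l'" for i j l l'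
  proof -
    have "t i / t j = ?q ^ l' / ?q ^ l"
      using eq assms(1)[OF j] by (simp add: field_simps)
    also have "\<dots> = ?q powi (int l' - int l)"
      by (simp add: power_int_diff)
    finally have "i = j"
      using assms(2)[OF i j] by blast
    hence "?q ^ l = ?q ^ l'"
      using eq assms(1)[OF j] by simp
    hence "q ^ l = q ^ l'" by (metis of_real_eq_iff of_real_power)
    thus ?thesis using \<open>i = j\<close> q_pos q_less_1 by (simp add: power_inject_exp')
  qed
  hence "inj_on (\<lambda>(j, l). t j * ?q ^ l) (SIGMA j:{1..r}. {..<n j})"
    by (auto intro!: inj_onI)
  thus ?thesis
    by (simp add: jacobi_nodes_def card_image)
qed

lemma is_multiple_little_q_jacobi_iff:
  assumes "norm \<beta> < 1" "\<And>j. j \<in> {1..r} \<Longrightarrow> norm (t j) < 1"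
  shows "is_multiple_little_q_jacobi q r n (\<lambda>j. t j / of_real q) (\<beta> / of_real q) p \<longleftrightarrow>
    degree p = (\<Sum>j=1..r. n j) \<and> poly p 0 = 1 \<and>
    (\<forall>y\<in>jacobi_nodes r n t. ratio_transform \<beta> p y = 0)"
proof -
  have "(\<lambda>k. poly p (of_real q ^ k) * of_real q ^ (k * l) * (t j / of_real q * of_real q) ^ k *
             (qpoch (\<beta> / of_real q * of_real q) q k / qpoch (of_real q) q k)) sums 0 \<longleftrightarrow>
        ratio_transform \<beta> p (t j * of_real q ^ l) = 0" if "j \<in> {1..r}" for j l
  proof -
    let ?y = "t j * of_real q ^ l"
    have y: "norm ?y < 1" by (rule norm_mult_q_power_less_1[OF assms(2)[OF that]])
    have summand: "poly p (of_real q ^ k) * of_real q ^ (k * l) * (t j / of_real q * of_real q) ^ k *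
             (qpoch (\<beta> / of_real q * of_real q) q k / qpoch (of_real q) q k) =
        poly p (of_real q ^ k) * ?y ^ k * qbin_coeff \<beta> k" for k
    proof -
      have "complex_of_real q ^ (k * l) = (of_real q ^ l) ^ k"
        by (simp only: power_mult[symmetric] mult.commute)
      thus ?thesis
        by (simp add: qbin_coeff_def power_mult_distrib)
    qed
    have "(\<lambda>k. poly p (of_real q ^ k) * ?y ^ k * qbin_coeff \<beta> k) sums 0 \<longleftrightarrow>
        qbin_series \<beta> ?y * ratio_transform \<beta> p ?y = 0"
      using poly_qbin_sums[OF y assms(1), of p] sums_unique2 by fastforce
    thus ?thesis
      unfolding summand using qbin_series_nonzero[OF y assms(1)] by simp
  qed
  thus ?thesis
    unfolding is_multiple_little_q_jacobi_def jacobi_nodes_def by auto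
qed

text \<open>
  A recognition criterion for the multiple little q-Jacobi polynomial. A degree below \<open>|n|\<close> is excluded
  by zero counting and the value \<open>1\<close> at \<open>0\<close>. If \<open>p'\<close> is another solution, then the combination of \<open>p\<close> and
  \<open>p'\<close> in which the leading terms cancel has too many zeros, so \<open>p\<close> and \<open>p'\<close> are proportional; their
  values at \<open>0\<close> agree.
\<close>

lemma multiple_little_q_jacobi_eqI:
  assumes \<beta>: "norm \<beta> < 1" and t: "\<And>j. j \<in> {1..r} \<Longrightarrow> norm (t j) < 1"
    and card: "card (jacobi_nodes r n t) = (\<Sum>j=1..r. n j)"
    and deg: "degree p \<le> (\<Sum>j=1..r. n j)" and p_0: "poly p 0 = 1"
    and zeros: "\<And>y. y \<in> jacobi_nodes r n t \<Longrightarrow> ratio_transform \<beta> p y = 0"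
  shows "degree p = (\<Sum>j=1..r. n j)"
    and "multiple_little_q_jacobi q r n (\<lambda>j. t j / of_real q) (\<beta> / of_real q) = p"
proof -
  let ?N = "\<Sum>j=1..r. n j"
  have norm_node: "norm y < 1" if "y \<in> jacobi_nodes r n t" for y
    using that t norm_mult_q_power_less_1 by (elim jacobi_nodesE) auto
  have normal: "p' = 0"
    if "degree p' < ?N" "\<And>y. y \<in> jacobi_nodes r n t \<Longrightarrow> ratio_transform \<beta> p' y = 0" for p'
    using ratio_transform_eq_0_imp_eq_0[OF \<beta> finite_jacobi_nodes[of r n t], of p'] that norm_node card
    by auto
  show deg_p: "degree p = ?N"
    using normal[of p] zeros deg p_0 by force
  show "multiple_little_q_jacobi q r n (\<lambda>j. t j / of_real q) (\<beta> / of_real q) = p"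
    unfolding multiple_little_q_jacobi_def
  proof (rule the_equality)
    let ?is_jacobi = "is_multiple_little_q_jacobi q r n (\<lambda>j. t j / of_real q) (\<beta> / of_real q)"
    have iff: "?is_jacobi p' \<longleftrightarrow> degree p' = ?N \<and> poly p' 0 = 1 \<and>
        (\<forall>y\<in>jacobi_nodes r n t. ratio_transform \<beta> p' y = 0)" for p'
      by (rule is_multiple_little_q_jacobi_iff[OF \<beta> t])
    show "?is_jacobi p"
      unfolding iff using deg_p p_0 zeros by blast
    fix p'
    assume "?is_jacobi p'"
    hence p': "degree p' = ?N \<and> poly p' 0 = 1 \<and>
        (\<forall>y\<in>jacobi_nodes r n t. ratio_transform \<beta> p' y = 0)"
      unfolding iff .
    let ?d = "smult (lead_coeff p') p - smult (lead_coeff p) p'"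
    have "degree ?d \<le> ?N"
      using deg_p p' by (intro degree_diff_le order.trans[OF degree_smult_le]) auto
    moreover have "coeff ?d ?N = 0"
      using deg_p p' by simp
    ultimately have "?d = 0 \<or> degree ?d < ?N"
      by (rule eq_zero_or_degree_less)
    hence "?d = 0"
      using normal[of ?d] zeros p' by (auto simp: ratio_transform_diff_smult)
    hence eq: "smult (lead_coeff p') p = smult (lead_coeff p) p'" by simp
    from arg_cong[OF this, of "\<lambda>p. poly p 0"] have lead: "lead_coeff p' = lead_coeff p"
      using p_0 p' by simp
    have "lead_coeff p \<noteq> 0" using p_0 by auto
    moreover have "smult (lead_coeff p) (p' - p) = 0"
      using eq lead by (simp add: smult_diff_right)
    ultimately show "p' = p" by simp
  qed
qed

end

section \<open>The q-Pfaff--Saalschuetz sum\<close>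

context q_base
begin


text \<open>
  The part \<open>(q\<^sup>-\<^sup>n)\<^sub>k q\<^sup>k / (q)\<^sub>k\<close> of a terminating basic hypergeometric summand. It is
  \<open>(-1)\<^sup>k\<close> times a q-binomial coefficient and a power of \<open>q\<close>, whence the two recurrences below.
\<close>

definition saalschuetz_coeff :: "nat \<Rightarrow> nat \<Rightarrow> complex" where
  "saalschuetz_coeff n k =
     qpoch (inverse (of_real q ^ n)) q k * of_real q ^ k / qpoch (of_real q) q k"

lemma saalschuetz_coeff_0 [simp]: "saalschuetz_coeff n 0 = 1"
  by (simp add: saalschuetz_coeff_def)

lemma saalschuetz_coeff_eq_0: "n < k \<Longrightarrow> saalschuetz_coeff n k = 0"
  by (simp add: saalschuetz_coeff_def qpoch_inverse_power_eq_0)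

lemma one_minus_q_power_Suc_nonzero: "1 - complex_of_real q * of_real q ^ m \<noteq> 0"
  using qpoch_q_nonzero[of "Suc m"] by (simp add: qpoch_Suc)

lemma saalschuetz_coeff_Suc:
  "of_real q ^ n * (1 - of_real q ^ Suc m) * saalschuetz_coeff n (Suc m) =
     of_real q * (of_real q ^ n - of_real q ^ m) * saalschuetz_coeff n m"
proof -
  let ?q = "complex_of_real q"
  have "saalschuetz_coeff n (Suc m) * (1 - ?q * ?q ^ m) =
      saalschuetz_coeff n m * (?q * (1 - inverse (?q ^ n) * ?q ^ m))"
    using one_minus_q_power_Suc_nonzero[of m] by (simp add: saalschuetz_coeff_def qpoch_Suc)
  hence "?q ^ n * (saalschuetz_coeff n (Suc m) * (1 - ?q * ?q ^ m)) =
      saalschuetz_coeff n m * (?q * (?q ^ n * (1 - inverse (?q ^ n) * ?q ^ m)))"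
    by (simp add: mult_ac)
  also have "?q ^ n * (1 - inverse (?q ^ n) * ?q ^ m) = ?q ^ n - ?q ^ m"
    by (simp add: right_diff_distrib flip: mult.assoc)
  finally show ?thesis by (simp add: mult_ac)
qed

lemma saalschuetz_coeff_pascal:
  "of_real q ^ Suc m * saalschuetz_coeff (Suc n) (Suc m) = saalschuetz_coeff n (Suc m) - of_real q * saalschuetz_coeff n m"
proof -
  let ?q = "complex_of_real q"
  \<comment> \<open>Removing the first factor turns \<open>q\<^sup>-\<^sup>n\<^sup>-\<^sup>1\<close> into \<open>q\<^sup>-\<^sup>n\<close>.\<close>
  have split: "qpoch (inverse (?q ^ Suc n)) q (Suc m) =
      (1 - inverse (?q ^ Suc n)) * qpoch (inverse (?q ^ n)) q m"
    unfolding qpoch_Suc_left[of "inverse (?q ^ Suc n)"] by (simp add: field_simps)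
  have "?q ^ n * ((1 - ?q ^ Suc m) * (?q ^ Suc m * saalschuetz_coeff (Suc n) (Suc m))) =
      ?q ^ n * (1 - inverse (?q ^ Suc n)) * ?q * ?q ^ Suc m * saalschuetz_coeff n m"
    using one_minus_q_power_Suc_nonzero[of m] split
    by (simp add: saalschuetz_coeff_def qpoch_Suc mult_ac)
  also have "?q ^ n * (1 - inverse (?q ^ Suc n)) * ?q = ?q * ?q ^ n - 1"
    by (simp add: field_simps)
  also have "(?q * ?q ^ n - 1) * ?q ^ Suc m * saalschuetz_coeff n m =
      ?q * (?q ^ n - ?q ^ m) * saalschuetz_coeff n m - ?q * ?q ^ n * (1 - ?q ^ Suc m) * saalschuetz_coeff n m"
    by (simp add: algebra_simps)
  also have "\<dots> = ?q ^ n * ((1 - ?q ^ Suc m) * (saalschuetz_coeff n (Suc m) - ?q * saalschuetz_coeff n m))"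
    unfolding saalschuetz_coeff_Suc[symmetric] by (simp add: algebra_simps)
  finally show ?thesis
    using one_minus_q_power_Suc_nonzero[of m] by simp
qed

text \<open>
  The sum for \<open>n + 1\<close> and \<open>\<beta>\<close> is compared with the one for \<open>n\<close> and \<open>\<beta> q\<close>; both have the same parameter
  \<open>t \<beta> q\<^sup>n\<close>. With the right weights the difference of the summands telescopes. The form of the right-hand side is
  forced: its dependence on \<open>k\<close> is found by comparing coefficients of \<open>t\<close>, \<open>y\<close> and \<open>\<beta>\<close> in the
  telescoping identity.
\<close>

lemma q_saalschuetz_telescope:
  assumes "norm t < 1" "norm (\<beta> * y) < 1"
  shows "(\<Sum>k\<le>m. (saalschuetz_coeff (Suc n) k * (1 - t * of_real q ^ n)
            - (1 - \<beta>) * (y - t * of_real q ^ n) * saalschuetz_coeff n k / (1 - \<beta> * y * of_real q ^ k)) *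
          (qpoch (t * \<beta> * of_real q ^ n) q k * qpoch y q k / (qpoch t q k * qpoch (\<beta> * y) q k))) =
    saalschuetz_coeff n m / of_real q ^ m *
      (qpoch (t * \<beta> * of_real q ^ n) q (Suc m) * qpoch y q (Suc m) /
        (qpoch t q m * qpoch (\<beta> * y) q (Suc m)))"
    (is "(\<Sum>k\<le>m. ?c k * ?V k) = ?H m")
proof -
  let ?q = "complex_of_real q"
  have nz: "1 - t * ?q ^ k \<noteq> 0" "1 - \<beta> * y * ?q ^ k \<noteq> 0" "qpoch t q k \<noteq> 0" "qpoch (\<beta> * y) q k \<noteq> 0" for k
    using assms by (auto intro!: one_minus_nonzero norm_mult_q_power_less_1 qpoch_nonzero simp del: right_minus_eq)
  have H: "?H m = saalschuetz_coeff n m / ?q ^ m * ?V m *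
      ((1 - t * \<beta> * ?q ^ n * ?q ^ m) * (1 - y * ?q ^ m) / (1 - \<beta> * y * ?q ^ m))" for m
    by (simp only: qpoch_Suc divide_inverse inverse_mult_distrib mult_ac)
  have H': "?H m = saalschuetz_coeff n m / ?q ^ m * ?V (Suc m) * (1 - t * ?q ^ m)" for m
    using nz(1)[of m] by (simp add: qpoch_Suc)
  show ?thesis
  proof (induction m)
    case 0
    have "(1 - t * ?q ^ n) * (1 - \<beta> * y) - (1 - \<beta>) * (y - t * ?q ^ n) =
        (1 - t * \<beta> * ?q ^ n) * (1 - y)"
      by algebra
    thus ?case
      using nz(2)[of 0] by (simp add: qpoch_Suc divide_simps)
  next
    case (Suc m)
    \<comment> \<open>Written in these variables, the induction step is a polynomial identity in \<open>t\<close>, \<open>y\<close>, \<open>\<beta>\<close>. It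
       holds modulo the two recurrences for the coefficients, which enter as \<open>pascal\<close> and \<open>rec\<close>.\<close>
    define x U u g where "x = ?q ^ Suc m" and "U = saalschuetz_coeff (Suc n) (Suc m)"
      and "u = saalschuetz_coeff n (Suc m)" and "g = saalschuetz_coeff n m / ?q ^ m"
    define w where "w = 1 - \<beta> * y * x"
    have w: "w \<noteq> 0" using nz(2)[of "Suc m"] by (simp add: w_def x_def)
    have x: "x \<noteq> 0" by (simp add: x_def)
    have g: "?q * saalschuetz_coeff n m = x * g" by (simp add: g_def x_def)
    have pascal: "x * U = u - x * g"
      using saalschuetz_coeff_pascal[of m n] g by (simp add: x_def U_def u_def)
    have rec: "?q ^ n * (1 - x) * u = (?q ^ n - ?q ^ m) * (x * g)"
      using saalschuetz_coeff_Suc[of n m] g by (simp add: x_def u_def mult_ac)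
    have "x * (w * U * (1 - t * ?q ^ n) - (1 - \<beta>) * (y - t * ?q ^ n) * u + w * g * (1 - t * ?q ^ m)) =
        (x * U) * w * (1 - t * ?q ^ n) - x * ((1 - \<beta>) * (y - t * ?q ^ n) * u) +
        x * (w * g * (1 - t * ?q ^ m))"
      by (simp only: distrib_left right_diff_distrib mult_ac)
    also have "\<dots> = u * (1 - t * \<beta> * ?q ^ n * x) * (1 - y * x) +
        t * w * ((?q ^ n - ?q ^ m) * (x * g) - ?q ^ n * (1 - x) * u)"
      unfolding pascal w_def by (simp add: algebra_simps)
    also have "\<dots> = u * (1 - t * \<beta> * ?q ^ n * x) * (1 - y * x)"
      unfolding rec by simp
    finally have "x * (w * U * (1 - t * ?q ^ n) - (1 - \<beta>) * (y - t * ?q ^ n) * u + w * g * (1 - t * ?q ^ m)) =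
        u * (1 - t * \<beta> * ?q ^ n * x) * (1 - y * x)" .
    hence key: "?c (Suc m) + g * (1 - t * ?q ^ m) =
        u / x * ((1 - t * \<beta> * ?q ^ n * x) * (1 - y * x) / w)"
      using x w unfolding U_def[symmetric] u_def[symmetric] x_def[symmetric] w_def[symmetric]
      by (simp add: divide_simps) (simp add: mult_ac)
    have "(\<Sum>k\<le>Suc m. ?c k * ?V k) = ?H m + ?c (Suc m) * ?V (Suc m)"
      unfolding sum.atMost_Suc Suc.IH ..
    also have "?H m = g * (1 - t * ?q ^ m) * ?V (Suc m)"
      unfolding H' g_def by (simp only: mult_ac)
    also have "g * (1 - t * ?q ^ m) * ?V (Suc m) + ?c (Suc m) * ?V (Suc m) =
        (?c (Suc m) + g * (1 - t * ?q ^ m)) * ?V (Suc m)"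
      by (simp only: distrib_right add.commute)
    also have "\<dots> = ?H (Suc m)"
      unfolding key H x_def u_def w_def by (simp only: mult_ac)
    finally show ?case .
  qed
qed

text \<open>
  The q-Pfaff--Saalschuetz sum, with numerator parameters \<open>q\<^sup>-\<^sup>n\<close>, \<open>t \<beta> q\<^sup>n\<^sup>-\<^sup>1\<close>, \<open>y\<close> and denominator parameters
  \<open>t\<close>, \<open>\<beta> y\<close>. The right-hand side shows the zeros \<open>y = t q\<^sup>i\<close>. Summing the telescoping identity over
  \<open>k \<le> n + 1\<close> gives \<open>0\<close>, because the coefficient for \<open>n\<close> vanishes at \<open>k = n + 1\<close>; this reduces \<open>n + 1\<close> and \<open>\<beta>\<close> to
  \<open>n\<close> and \<open>\<beta> q\<close>.
\<close>

lemma q_saalschuetz: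
  assumes "norm t < 1" "norm (\<beta> * y) < 1"
  shows "(\<Sum>k\<le>n. saalschuetz_coeff n k * (qpoch (t * \<beta> * of_real q ^ n / of_real q) q k * qpoch y q k /
            (qpoch t q k * qpoch (\<beta> * y) q k))) =
         qpoch \<beta> q n * (\<Prod>i<n. y - t * of_real q ^ i) / (qpoch t q n * qpoch (\<beta> * y) q n)"
  using assms(2)
proof (induction n arbitrary: \<beta>)
  case (Suc n)
  let ?q = "complex_of_real q"
  define V where
    "V k = qpoch (t * \<beta> * ?q ^ n) q k * qpoch y q k / (qpoch t q k * qpoch (\<beta> * y) q k)" for k
  define S where "S = (\<Sum>k\<le>Suc n. saalschuetz_coeff (Suc n) k * V k)"
  have \<beta>q: "norm (\<beta> * ?q * y) < 1"
    using norm_mult_q_power_less_1[OF Suc.prems, of 1] by (simp add: mult_ac)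
  have nz: "1 - \<beta> * y * ?q ^ k \<noteq> 0" "qpoch (\<beta> * y) q k \<noteq> 0" for k
    using Suc.prems by (auto intro!: one_minus_nonzero norm_mult_q_power_less_1 qpoch_nonzero simp del: right_minus_eq)
  have t_nz: "1 - t * ?q ^ n \<noteq> 0"
    by (intro one_minus_nonzero norm_mult_q_power_less_1 assms(1))
  have \<beta>y: "1 - \<beta> * y \<noteq> 0" using nz(1)[of 0] by simp
  have shift: "qpoch (\<beta> * y) q (Suc k) = (1 - \<beta> * y) * qpoch (\<beta> * ?q * y) q k" for k
    by (simp add: qpoch_Suc_left mult_ac)
  have ratio: "V k / (1 - \<beta> * y * ?q ^ k) =
      (qpoch (t * \<beta> * ?q ^ n) q k * qpoch y q k / (qpoch t q k * qpoch (\<beta> * ?q * y) q k)) / (1 - \<beta> * y)" for k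
  proof -
    have "qpoch (\<beta> * y) q k * (1 - \<beta> * y * ?q ^ k) = (1 - \<beta> * y) * qpoch (\<beta> * ?q * y) q k"
      using shift[of k] by (simp add: qpoch_Suc)
    thus ?thesis by (simp add: V_def mult_ac)
  qed
  have "(\<Sum>k\<le>Suc n. (saalschuetz_coeff (Suc n) k * (1 - t * ?q ^ n)
      - (1 - \<beta>) * (y - t * ?q ^ n) * saalschuetz_coeff n k / (1 - \<beta> * y * ?q ^ k)) * V k) = 0"
    unfolding V_def q_saalschuetz_telescope[OF assms(1) Suc.prems] by (simp add: saalschuetz_coeff_eq_0)
  moreover have "(saalschuetz_coeff (Suc n) k * (1 - t * ?q ^ n)
      - (1 - \<beta>) * (y - t * ?q ^ n) * saalschuetz_coeff n k / (1 - \<beta> * y * ?q ^ k)) * V k =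
      (1 - t * ?q ^ n) * (saalschuetz_coeff (Suc n) k * V k) -
      (1 - \<beta>) * (y - t * ?q ^ n) * (saalschuetz_coeff n k * (V k / (1 - \<beta> * y * ?q ^ k)))" for k
    by (subst left_diff_distrib) (simp only: divide_inverse mult_ac)
  ultimately have "(1 - t * ?q ^ n) * S =
      (\<Sum>k\<le>Suc n. (1 - \<beta>) * (y - t * ?q ^ n) * (saalschuetz_coeff n k * (V k / (1 - \<beta> * y * ?q ^ k))))"
    unfolding S_def sum_distrib_left by (simp only: sum_subtractf right_minus_eq)
  also have "\<dots> = (1 - \<beta>) * (y - t * ?q ^ n) / (1 - \<beta> * y) *
      (\<Sum>k\<le>Suc n. saalschuetz_coeff n k *
        (qpoch (t * (\<beta> * ?q) * ?q ^ n / ?q) q k * qpoch y q k / (qpoch t q k * qpoch (\<beta> * ?q * y) q k)))"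
    unfolding ratio sum_distrib_left by (simp add: mult_ac del: sum.atMost_Suc)
  also have "(\<Sum>k\<le>Suc n. saalschuetz_coeff n k *
        (qpoch (t * (\<beta> * ?q) * ?q ^ n / ?q) q k * qpoch y q k / (qpoch t q k * qpoch (\<beta> * ?q * y) q k))) =
      qpoch (\<beta> * ?q) q n * (\<Prod>i<n. y - t * ?q ^ i) / (qpoch t q n * qpoch (\<beta> * ?q * y) q n)"
    using Suc.IH[OF \<beta>q] by (simp add: saalschuetz_coeff_eq_0)
  finally have "(1 - t * ?q ^ n) * S =
      ((1 - \<beta>) * qpoch (\<beta> * ?q) q n) * ((\<Prod>i<n. y - t * ?q ^ i) * (y - t * ?q ^ n)) /
      (qpoch t q n * ((1 - \<beta> * y) * qpoch (\<beta> * ?q * y) q n))"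
    by (simp add: mult_ac)
  also have "(1 - \<beta>) * qpoch (\<beta> * ?q) q n = qpoch \<beta> q (Suc n)"
    by (simp add: qpoch_Suc_left)
  also have "(1 - \<beta> * y) * qpoch (\<beta> * ?q * y) q n = qpoch (\<beta> * y) q (Suc n)"
    by (simp add: shift)
  finally have "S = qpoch \<beta> q (Suc n) * ((\<Prod>i<n. y - t * ?q ^ i) * (y - t * ?q ^ n)) /
      (qpoch t q n * qpoch (\<beta> * y) q (Suc n)) / (1 - t * ?q ^ n)"
    using t_nz by (metis nonzero_mult_div_cancel_left)
  thus ?case
    unfolding S_def V_def by (simp add: qpoch_Suc[of t] mult_ac)
qed simp

end

section \<open>Multiple little q-Jacobi polynomials as multiple sums\<close>

lemma sum_coeff_sum_monom:
  fixes g :: "'a \<Rightarrow> 'b::comm_semiring_1" and e :: "'a \<Rightarrow> nat"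
  assumes "finite A" "\<And>k. k \<in> A \<Longrightarrow> e k \<le> M"
  shows "(\<Sum>m\<le>M. coeff (\<Sum>k\<in>A. monom (g k) (e k)) m * h m) = (\<Sum>k\<in>A. g k * h (e k))"
proof -
  have "(\<Sum>m\<le>M. coeff (\<Sum>k\<in>A. monom (g k) (e k)) m * h m) =
      (\<Sum>m\<le>M. \<Sum>k\<in>A. (if m = e k then g k * h m else 0))"
    by (auto simp: coeff_sum sum_distrib_right intro!: sum.cong)
  also have "\<dots> = (\<Sum>k\<in>A. \<Sum>m\<le>M. (if m = e k then g k * h m else 0))"
    by (rule sum.swap)
  also have "\<dots> = (\<Sum>k\<in>A. g k * h (e k))"
    using assms(2) by (intro sum.cong refl) simp
  finally show ?thesis .
qed

context q_base
begin

text \<open>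
  The factors of the explicit coefficient that belong to the index \<open>j\<close>, in the notation \<open>t\<^sub>j = a\<^sub>j b\<close> and
  \<open>\<beta> = c d\<close>. The same formula serves \<open>j = r\<close>, where the empty tail sum makes the additional factors
  equal to \<open>1\<close>. It depends only on \<open>k\<^sub>j, \<dots>, k\<^sub>r\<close>, so that the sum can be evaluated starting with \<open>k\<^sub>1\<close>.
\<close>

definition multiple_jacobi_factor ::
    "nat \<Rightarrow> (nat \<Rightarrow> nat) \<Rightarrow> (nat \<Rightarrow> complex) \<Rightarrow> complex \<Rightarrow> nat \<Rightarrow> (nat \<Rightarrow> nat) \<Rightarrow> complex" where
  "multiple_jacobi_factor r n t \<beta> j k =
     qpoch (inverse (of_real q ^ n j)) q (k j) *
     qpoch (t j * \<beta> * of_real q ^ (\<Sum>i=1..j. n i) / of_real q * of_real q ^ tail_sum r k (Suc j)) q (k j) *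
     qpoch (t j * of_real q ^ n j) q (tail_sum r k (Suc j)) /
     (qpoch (of_real q) q (k j) * qpoch (t j) q (tail_sum r k j) *
      of_real q ^ (n j * tail_sum r k (Suc j)))"

definition multiple_jacobi_poly ::
    "nat \<Rightarrow> (nat \<Rightarrow> nat) \<Rightarrow> (nat \<Rightarrow> complex) \<Rightarrow> complex \<Rightarrow> complex poly" where
  "multiple_jacobi_poly r n t \<beta> = (\<Sum>k\<in>(\<Pi>\<^sub>E j\<in>{1..r}. {0..n j}).
     monom ((\<Prod>j=1..r. multiple_jacobi_factor r n t \<beta> j k) * of_real q ^ tail_sum r k 1) (tail_sum r k 1))"

lemma tail_sum_Suc: "s \<le> r \<Longrightarrow> tail_sum r k s = k s + tail_sum r k (Suc s)"
  by (simp add: tail_sum_def sum.atLeast_Suc_atMost)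

lemma tail_sum_upd: "s < j \<Longrightarrow> tail_sum r (k(s := x)) j = tail_sum r k j"
  by (simp add: tail_sum_def)

text \<open>
  The sum over one index \<open>x\<close>, with the sum \<open>K\<close> of the later indices fixed, is a q-Pfaff--Saalschuetz sum
  for \<open>t q\<^sup>K\<close> and \<open>y q\<^sup>K\<close>. Its value has the shape of a summand of the remaining sum, with \<open>\<beta>\<close> replaced by
  \<open>\<beta> q\<^sup>n\<close>.
\<close>

lemma multiple_jacobi_innermost_sum:
  assumes "norm t < 1" "norm (\<beta> * y) < 1"
  shows "(\<Sum>x\<le>n. qpoch (inverse (of_real q ^ n)) q x *
            qpoch (t * \<beta> * of_real q ^ n / of_real q * of_real q ^ K) q x *
            qpoch (t * of_real q ^ n) q K /
            (qpoch (of_real q) q x * qpoch t q (x + K) * of_real q ^ (n * K)) *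
            (of_real q ^ (x + K) * (qpoch y q (x + K) / qpoch (\<beta> * y) q (x + K)))) =
         qpoch \<beta> q n * (\<Prod>i<n. y - t * of_real q ^ i) / (qpoch t q n * qpoch (\<beta> * y) q n) *
         (of_real q ^ K * (qpoch y q K / qpoch (\<beta> * of_real q ^ n * y) q K))"
    (is "?lhs = ?rhs")
proof -
  let ?q = "complex_of_real q"
  let ?t = "t * ?q ^ K" and ?y = "y * ?q ^ K"
  let ?c = "?q ^ K * qpoch (t * ?q ^ n) q K * qpoch y q K /
            (qpoch t q K * ?q ^ (n * K) * qpoch (\<beta> * y) q K)"
  have t: "norm ?t < 1"
    by (rule norm_mult_q_power_less_1[OF assms(1)])
  have y: "norm (\<beta> * ?y) < 1"
    using norm_mult_q_power_less_1[OF assms(2), of K] by (simp add: mult_ac)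
  have split: "qpoch z q (x + K) = qpoch z q K * qpoch (z * ?q ^ K) q x" for z x
    using qpoch_add[of z K x] by (simp add: add.commute)
  have "?lhs = (\<Sum>x\<le>n. ?c * (saalschuetz_coeff n x *
      (qpoch (?t * \<beta> * ?q ^ n / ?q) q x * qpoch ?y q x / (qpoch ?t q x * qpoch (\<beta> * ?y) q x))))"
  proof (intro sum.cong refl)
    fix x
    have "t * \<beta> * ?q ^ n / ?q * ?q ^ K = ?t * \<beta> * ?q ^ n / ?q" "\<beta> * y * ?q ^ K = \<beta> * ?y"
      by simp_all
    thus "qpoch (inverse (of_real q ^ n)) q x *
            qpoch (t * \<beta> * of_real q ^ n / of_real q * of_real q ^ K) q x *
            qpoch (t * of_real q ^ n) q K /
            (qpoch (of_real q) q x * qpoch t q (x + K) * of_real q ^ (n * K)) *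
            (of_real q ^ (x + K) * (qpoch y q (x + K) / qpoch (\<beta> * y) q (x + K))) =
          ?c * (saalschuetz_coeff n x *
      (qpoch (?t * \<beta> * ?q ^ n / ?q) q x * qpoch ?y q x / (qpoch ?t q x * qpoch (\<beta> * ?y) q x)))"
      unfolding split saalschuetz_coeff_def power_add
      by (simp only: divide_inverse inverse_mult_distrib mult_ac)
  qed
  also have "\<dots> = ?c * (qpoch \<beta> q n * (\<Prod>i<n. ?y - ?t * ?q ^ i) / (qpoch ?t q n * qpoch (\<beta> * ?y) q n))"
    unfolding sum_distrib_left[symmetric] q_saalschuetz[OF t y] ..
  \<comment> \<open>The power of \<open>q\<close> extracted here cancels the denominator \<open>q\<^sup>n\<^sup>K\<close>.\<close>
  also have "(\<Prod>i<n. ?y - ?t * ?q ^ i) = ?q ^ (n * K) * (\<Prod>i<n. y - t * ?q ^ i)"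
  proof -
    have "(\<Prod>i<n. ?y - ?t * ?q ^ i) = (\<Prod>i<n. ?q ^ K * (y - t * ?q ^ i))"
      by (intro prod.cong refl) (simp add: algebra_simps)
    thus ?thesis
      by (simp add: prod.distrib mult.commute flip: power_mult)
  qed
  also have "?c * (qpoch \<beta> q n * (?q ^ (n * K) * (\<Prod>i<n. y - t * ?q ^ i)) / (qpoch ?t q n * qpoch (\<beta> * ?y) q n)) =
      qpoch \<beta> q n * (\<Prod>i<n. y - t * ?q ^ i) * ?q ^ K * qpoch y q K *
      (qpoch (t * ?q ^ n) q K / (qpoch t q K * qpoch ?t q n)) /
      (qpoch (\<beta> * y) q K * qpoch (\<beta> * ?y) q n)"
    by (simp add: mult_ac)
  also have "qpoch (t * ?q ^ n) q K / (qpoch t q K * qpoch ?t q n) = 1 / qpoch t q n"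
  proof -
    have "qpoch t q K * qpoch ?t q n = qpoch t q n * qpoch (t * ?q ^ n) q K"
      using qpoch_add[of t K n] qpoch_add[of t n K] by (simp add: add.commute)
    moreover have "qpoch (t * ?q ^ n) q K \<noteq> 0"
      by (intro qpoch_nonzero norm_mult_q_power_less_1 assms(1))
    ultimately show ?thesis by simp
  qed
  also have "qpoch (\<beta> * y) q K * qpoch (\<beta> * ?y) q n = qpoch (\<beta> * y) q n * qpoch (\<beta> * ?q ^ n * y) q K"
    using qpoch_add[of "\<beta> * y" K n] qpoch_add[of "\<beta> * y" n K] by (simp add: add.commute mult_ac)
  also have "qpoch \<beta> q n * (\<Prod>i<n. y - t * ?q ^ i) * ?q ^ K * qpoch y q K * (1 / qpoch t q n) /
      (qpoch (\<beta> * y) q n * qpoch (\<beta> * ?q ^ n * y) q K) = ?rhs"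
    by (simp add: mult.assoc)
  finally show ?thesis .
qed

text \<open>
  Evaluating the sum over \<open>k\<^sub>s\<close> gives a constant, which contains \<open>\<Prod>\<^sub>i (y - t\<^sub>s q\<^sup>i)\<close>, times the sum over the
  later indices. The node \<open>y\<close> is a zero of this constant if \<open>j = s\<close>, and of the remaining sum
  otherwise. The exponent of \<open>q\<close> next to \<open>\<beta>\<close> records the indices already summed.
\<close>

lemma multiple_jacobi_tail_sum_vanishes:
  assumes t: "\<And>j. j \<in> {1..r} \<Longrightarrow> norm (t j) < 1" and "norm (\<beta> * y) < 1" "1 \<le> s" "s \<le> r"
    and "j \<in> {s..r}" "l < n j" "y = t j * of_real q ^ l"
  shows "(\<Sum>k\<in>(\<Pi>\<^sub>E j\<in>{s..r}. {0..n j}). (\<Prod>j=s..r. multiple_jacobi_factor r n t \<beta> j k) *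
           (of_real q ^ tail_sum r k s * (qpoch y q (tail_sum r k s) /
              qpoch (\<beta> * of_real q ^ (\<Sum>i=1..<s. n i) * y) q (tail_sum r k s)))) = 0"
  using \<open>1 \<le> s\<close> \<open>s \<le> r\<close> \<open>j \<in> {s..r}\<close>
proof (induction "r - s" arbitrary: s rule: less_induct)
  case less
  let ?q = "complex_of_real q"
  let ?rest = "\<lambda>k. \<Prod>j=Suc s..r. multiple_jacobi_factor r n t \<beta> j k"
  define B where "B s = \<beta> * ?q ^ (\<Sum>i=1..<s. n i)" for s
  let ?g = "\<lambda>s k. ?q ^ tail_sum r k s * (qpoch y q (tail_sum r k s) / qpoch (B s * y) q (tail_sum r k s))"
  define C where "C = qpoch (B s) q (n s) * (\<Prod>i<n s. y - t s * ?q ^ i) /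
      (qpoch (t s) q (n s) * qpoch (B s * y) q (n s))"
  have B_Suc: "B (Suc s) = B s * ?q ^ n s"
    using less.prems by (simp add: B_def power_add mult_ac)
  have X: "t s * \<beta> * ?q ^ (\<Sum>i=1..s. n i) / ?q = t s * B s * ?q ^ n s / ?q"
    using B_Suc by (simp add: B_def atLeastLessThanSuc_atLeastAtMost)
  have "norm (B s * y) < 1"
    using norm_mult_q_power_less_1[OF assms(2), of "\<Sum>i=1..<s. n i"] by (simp add: B_def mult_ac)
  hence inner: "(\<Sum>x\<le>n s. multiple_jacobi_factor r n t \<beta> s (k(s := x)) * ?g s (k(s := x))) = C * ?g (Suc s) k" for k
    using less.prems multiple_jacobi_innermost_sum[of "t s" "B s" y "n s" "tail_sum r k (Suc s)"] t[of s]
    by (simp only: multiple_jacobi_factor_def X tail_sum_Suc tail_sum_upd lessI fun_upd_same C_def B_Suc)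
       simp
  have interval: "{s..r} = insert s {Suc s..r}"
    using less.prems by auto
  have "(\<Sum>k\<in>(\<Pi>\<^sub>E j\<in>{s..r}. {0..n j}). (\<Prod>j=s..r. multiple_jacobi_factor r n t \<beta> j k) * ?g s k) =
      (\<Sum>(x, k)\<in>{0..n s} \<times> (\<Pi>\<^sub>E j\<in>{Suc s..r}. {0..n j}).
         ?rest k * (multiple_jacobi_factor r n t \<beta> s (k(s := x)) * ?g s (k(s := x))))"
    unfolding interval PiE_insert_eq
  proof (subst sum.reindex)
    show "inj_on (\<lambda>(y, g). g(s := y)) ({0..n s} \<times> (\<Pi>\<^sub>E j\<in>{Suc s..r}. {0..n j}))"
      by (rule inj_combinator) simp
    have "?rest (k(s := x)) = ?rest k" for k x
      by (intro prod.cong refl) (simp add: multiple_jacobi_factor_def tail_sum_upd)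
    thus "sum ((\<lambda>k. (\<Prod>j\<in>insert s {Suc s..r}. multiple_jacobi_factor r n t \<beta> j k) * ?g s k) \<circ> (\<lambda>(y, g). g(s := y)))
            ({0..n s} \<times> (\<Pi>\<^sub>E j\<in>{Suc s..r}. {0..n j})) =
          (\<Sum>(x, k)\<in>{0..n s} \<times> (\<Pi>\<^sub>E j\<in>{Suc s..r}. {0..n j}).
             ?rest k * (multiple_jacobi_factor r n t \<beta> s (k(s := x)) * ?g s (k(s := x))))"
      by (intro sum.cong refl) (auto simp: mult_ac)
  qed
  also have "\<dots> = (\<Sum>k\<in>(\<Pi>\<^sub>E j\<in>{Suc s..r}. {0..n j}). \<Sum>x\<le>n s.
         ?rest k * (multiple_jacobi_factor r n t \<beta> s (k(s := x)) * ?g s (k(s := x))))"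
    unfolding sum.cartesian_product[symmetric] atMost_atLeast0 by (rule sum.swap)
  also have "\<dots> = C * (\<Sum>k\<in>(\<Pi>\<^sub>E j\<in>{Suc s..r}. {0..n j}). ?rest k * ?g (Suc s) k)"
    unfolding sum_distrib_left[symmetric] inner by (simp only: sum_distrib_left mult_ac)
  also have "\<dots> = 0"
  proof (cases "j = s")
    case True
    hence "(\<Prod>i<n s. y - t s * ?q ^ i) = 0"
      using assms(6,7) by auto
    thus ?thesis by (simp add: C_def)
  next
    case False
    hence "j \<in> {Suc s..r}" "Suc s \<le> r" using less.prems by auto
    with less.hyps[of "Suc s"] less.prems show ?thesis by (simp add: B_def)
  qed
  finally show ?case by (simp add: B_def)
qed


lemma tail_sum_le:
  assumes "k \<in> (\<Pi>\<^sub>E j\<in>{1..r}. {0..n j})"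
  shows "tail_sum r k 1 \<le> (\<Sum>j=1..r. n j)"
  unfolding tail_sum_def using assms by (intro sum_mono) (auto dest!: PiE_mem)

lemma finite_index_box: "finite (\<Pi>\<^sub>E j\<in>{1..r}. {0..n j :: nat})" for r :: nat
  by (rule finite_PiE) auto

lemma degree_multiple_jacobi_poly_le: "degree (multiple_jacobi_poly r n t \<beta>) \<le> (\<Sum>j=1..r. n j)"
  unfolding multiple_jacobi_poly_def
  by (intro degree_sum_le order.trans[OF degree_monom_le tail_sum_le] finite_index_box)

lemma poly_multiple_jacobi_poly_0: "poly (multiple_jacobi_poly r n t \<beta>) 0 = 1"
proof -
  let ?A = "\<Pi>\<^sub>E j\<in>{1..r}. {0..n j}"
  define z :: "nat \<Rightarrow> nat" where "z = restrict (\<lambda>_. 0) {1..r}"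
  let ?c = "\<lambda>k. (\<Prod>j=1..r. multiple_jacobi_factor r n t \<beta> j k) * of_real q ^ tail_sum r k 1"
  have tail: "tail_sum r z j = 0" if "1 \<le> j" for j
    using that by (simp add: tail_sum_def z_def)
  have "poly (multiple_jacobi_poly r n t \<beta>) 0 = (\<Sum>k\<in>?A. ?c k * 0 ^ tail_sum r k 1)"
    by (simp add: multiple_jacobi_poly_def poly_sum poly_monom)
  also have "\<dots> = (\<Sum>k\<in>{z}. ?c k * 0 ^ tail_sum r k 1)"
  proof (rule sum.mono_neutral_right)
    show "\<forall>k\<in>?A - {z}. ?c k * 0 ^ tail_sum r k 1 = 0"
    proof
      fix k assume k: "k \<in> ?A - {z}"
      have "tail_sum r k 1 \<noteq> 0"
      proof
        assume "tail_sum r k 1 = 0"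
        hence "k = z"
          using k by (intro ext) (auto simp: z_def tail_sum_def restrict_def PiE_def extensional_def)
        thus False using k by simp
      qed
      thus "?c k * 0 ^ tail_sum r k 1 = 0" by simp
    qed
  qed (auto simp: z_def intro!: finite_PiE)
  also have "\<dots> = 1"
  proof -
    have "multiple_jacobi_factor r n t \<beta> j z = 1" if "j \<in> {1..r}" for j
      using that by (simp add: multiple_jacobi_factor_def tail z_def[THEN fun_cong])
    thus ?thesis using tail[of 1] by simp
  qed
  finally show ?thesis .
qed

text \<open>
  The ratio transform replaces \<open>x\<close> to the power \<open>k\<^sub>1 + \<dots> + k\<^sub>r\<close> by a ratio of shifted factorials; the
  result is the sum over all indices.
\<close>

lemma ratio_transform_multiple_jacobi_poly_node:
  assumes "norm \<beta> < 1" "\<And>j. j \<in> {1..r} \<Longrightarrow> norm (t j) < 1" "1 \<le> r" "y \<in> jacobi_nodes r n t"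
  shows "ratio_transform \<beta> (multiple_jacobi_poly r n t \<beta>) y = 0"
proof -
  from assms(4) obtain j l where jl: "j \<in> {1..r}" "l < n j" "y = t j * of_real q ^ l"
    by (rule jacobi_nodesE)
  have "norm (\<beta> * y) < 1"
    unfolding jl(3) by (intro norm_mult_less_1[OF assms(1)] norm_mult_q_power_less_1 assms(2) jl(1))
  have "ratio_transform \<beta> (multiple_jacobi_poly r n t \<beta>) y = (\<Sum>k\<in>(\<Pi>\<^sub>E j\<in>{1..r}. {0..n j}).
      (\<Prod>j=1..r. multiple_jacobi_factor r n t \<beta> j k) * of_real q ^ tail_sum r k 1 *
      (qpoch y q (tail_sum r k 1) / qpoch (\<beta> * y) q (tail_sum r k 1)))"
    unfolding ratio_transform_bound[OF degree_multiple_jacobi_poly_le]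
    unfolding multiple_jacobi_poly_def
    by (intro sum_coeff_sum_monom finite_index_box tail_sum_le)
  also have "\<dots> = (\<Sum>k\<in>(\<Pi>\<^sub>E j\<in>{1..r}. {0..n j}). (\<Prod>j=1..r. multiple_jacobi_factor r n t \<beta> j k) *
           (of_real q ^ tail_sum r k 1 * (qpoch y q (tail_sum r k 1) /
              qpoch (\<beta> * of_real q ^ (\<Sum>i=1..<1. n i) * y) q (tail_sum r k 1))))"
    by (simp add: mult.assoc)
  also have "\<dots> = 0"
    by (rule multiple_jacobi_tail_sum_vanishes[where j = j and l = l])
       (fact assms(2,3) \<open>norm (\<beta> * y) < 1\<close> jl order.refl)+
  finally show ?thesis .
qed

lemma multiple_little_q_jacobi_explicit:
  assumes "norm \<beta> < 1" "\<And>j. j \<in> {1..r} \<Longrightarrow> norm (t j) < 1" "1 \<le> r"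
    and "\<And>j. j \<in> {1..r} \<Longrightarrow> t j \<noteq> 0"
    and "\<And>i j m. i \<in> {1..r} \<Longrightarrow> j \<in> {1..r} \<Longrightarrow> i \<noteq> j \<Longrightarrow> t i / t j \<noteq> of_real q powi (m :: int)"
  shows "degree (multiple_jacobi_poly r n t \<beta>) = (\<Sum>j=1..r. n j)"
    and "multiple_little_q_jacobi q r n (\<lambda>j. t j / of_real q) (\<beta> / of_real q) = multiple_jacobi_poly r n t \<beta>"
proof -
  have card: "card (jacobi_nodes r n t) = (\<Sum>j=1..r. n j)"
    by (intro card_jacobi_nodes assms(4,5))
  have zeros: "ratio_transform \<beta> (multiple_jacobi_poly r n t \<beta>) y = 0" if "y \<in> jacobi_nodes r n t" for y
    using that by (intro ratio_transform_multiple_jacobi_poly_node assms(1-3))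
  note facts = assms(1,2) card degree_multiple_jacobi_poly_le poly_multiple_jacobi_poly_0 zeros
  show "degree (multiple_jacobi_poly r n t \<beta>) = (\<Sum>j=1..r. n j)"
    by (rule multiple_little_q_jacobi_eqI[where t = t]) (fact facts)+
  show "multiple_little_q_jacobi q r n (\<lambda>j. t j / of_real q) (\<beta> / of_real q) = multiple_jacobi_poly r n t \<beta>"
    by (rule multiple_little_q_jacobi_eqI[where t = t]) (fact facts)+
qed

end

section \<open>The operator T and the explicit expression\<close>

lemma cos_conv_cis: "2 * complex_of_real (cos \<theta>) = cis \<theta> + cis (- \<theta>)"
  by (simp add: complex_eq_iff)

context q_base
begin

lemma poly_askey_wilson_basis:
  "poly (askey_wilson_basis q b k) (of_real (cos \<theta>)) =
     qpoch (b * cis \<theta>) q k * qpoch (b * cis (- \<theta>)) q k"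
proof -
  have "poly [: 1 + b ^ 2 * of_real q ^ (2 * j), - 2 * b * of_real q ^ j :] (of_real (cos \<theta>)) =
      (1 - b * cis \<theta> * of_real q ^ j) * (1 - b * cis (- \<theta>) * of_real q ^ j)" for j
  proof -
    have "poly [: 1 + b ^ 2 * of_real q ^ (2 * j), - 2 * b * of_real q ^ j :] (of_real (cos \<theta>)) =
        1 + (b * of_real q ^ j) ^ 2 - b * of_real q ^ j * (2 * of_real (cos \<theta>))"
      using power_add[of "complex_of_real q" j j]
      by (simp add: algebra_simps power2_eq_square flip: mult_2)
    also have "\<dots> = (1 - b * cis \<theta> * of_real q ^ j) * (1 - b * cis (- \<theta>) * of_real q ^ j)
                   + (b * of_real q ^ j) ^ 2 * (1 - cis \<theta> * cis (- \<theta>))"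
      unfolding cos_conv_cis by (simp add: algebra_simps power2_eq_square)
    also have "cis \<theta> * cis (- \<theta>) = 1"
      by (simp add: cis_mult)
    finally show ?thesis by simp
  qed
  thus ?thesis
    by (simp add: askey_wilson_basis_def poly_prod qpoch_def prod.distrib)
qed

lemma T_op_bound:
  assumes "degree p \<le> M"
  shows "T_op q b c d p = (\<Sum>k\<le>M. smult (coeff p k / (qpoch (b * c) q k * qpoch (b * d) q k))
                         (askey_wilson_basis q b k))"
  unfolding T_op_def
  using assms by (intro sum.mono_neutral_left) (auto simp: coeff_eq_0)

lemma degree_askey_wilson_basis:
  assumes "b \<noteq> 0"
  shows "degree (askey_wilson_basis q b k) = k"
proof -
  have "degree (askey_wilson_basis q b k) =
      (\<Sum>j<k. degree [: 1 + b ^ 2 * of_real q ^ (2 * j), - 2 * b * of_real q ^ j :])"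
    unfolding askey_wilson_basis_def
    using assms by (intro degree_prod_eq_sum_degree) auto
  thus ?thesis using assms by simp
qed

text \<open>
  The basis polynomial of index \<open>k\<close> has degree exactly \<open>k\<close> because \<open>b \<noteq> 0\<close>, and the denominators do not vanish.
\<close>

lemma degree_T_op:
  assumes "norm b < 1" "norm c < 1" "norm d < 1" "b \<noteq> 0" "p \<noteq> 0"
  shows "T_op q b c d p \<noteq> 0" "degree (T_op q b c d p) = degree p"
proof -
  let ?D = "degree p"
  let ?g = "\<lambda>k. coeff p k / (qpoch (b * c) q k * qpoch (b * d) q k)"
  have "coeff (T_op q b c d p) ?D = (\<Sum>k\<le>?D. ?g k * coeff (askey_wilson_basis q b k) ?D)"
    by (simp add: T_op_def coeff_sum)
  also have "\<dots> = (\<Sum>k\<in>{?D}. ?g k * coeff (askey_wilson_basis q b k) ?D)"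
    by (rule sum.mono_neutral_right)
       (auto simp: coeff_eq_0 degree_askey_wilson_basis[OF assms(4)])
  also have "\<dots> \<noteq> 0"
  proof -
    have "coeff (askey_wilson_basis q b ?D) ?D = lead_coeff (askey_wilson_basis q b ?D)"
      by (simp add: degree_askey_wilson_basis[OF assms(4)])
    moreover have "askey_wilson_basis q b ?D \<noteq> 0"
      unfolding askey_wilson_basis_def using assms(4) by auto
    ultimately show ?thesis
      using assms by (simp add: qpoch_nonzero norm_mult_less_1)
  qed
  finally have nz: "coeff (T_op q b c d p) ?D \<noteq> 0" .
  thus "T_op q b c d p \<noteq> 0" by auto
  have "degree (T_op q b c d p) \<le> ?D"
    unfolding T_op_def
    by (intro degree_sum_le order.trans[OF degree_smult_le])
       (auto simp: degree_askey_wilson_basis[OF assms(4)])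
  with le_degree[OF nz] show "degree (T_op q b c d p) = ?D" by simp
qed

lemma X_param_eq:
  "X_param q n a b c d j = a j * b * (c * d) * of_real q ^ (\<Sum>i=1..j. n i) / of_real q"
  by (simp add: X_param_def power_int_diff del: of_nat_sum)

text \<open>
  A regrouping of factors: the factors with index \<open>r\<close>, which the explicit term lists separately, rejoin the
  product over \<open>j\<close> because the tail sum after \<open>r\<close> is empty.
\<close>

lemma explicit_term_eq:
  assumes "1 \<le> r"
  shows "explicit_term q r n a b c d \<theta> k =
    (\<Prod>j=1..r. multiple_jacobi_factor r n (\<lambda>j. a j * b) (c * d) j k) * of_real q ^ tail_sum r k 1 *
    (poly (askey_wilson_basis q b (tail_sum r k 1)) (of_real (cos \<theta>)) /
      (qpoch (b * c) q (tail_sum r k 1) * qpoch (b * d) q (tail_sum r k 1)))"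
proof -
  let ?q = "complex_of_real q"
  let ?K = "\<lambda>j. tail_sum r k (Suc j)"
  let ?F = "\<lambda>j. qpoch (inverse (?q ^ n j)) q (k j) / (qpoch ?q q (k j) * qpoch (a j * b) q (tail_sum r k j))"
  let ?X = "\<lambda>j. qpoch (X_param q n a b c d j * ?q ^ ?K j) q (k j)"
  let ?Y = "\<lambda>j. qpoch (a j * b * ?q ^ n j) q (?K j)"
  have "multiple_jacobi_factor r n (\<lambda>j. a j * b) (c * d) j k = ?F j * (?X j * ?Y j) / ?q ^ (n j * ?K j)" for j
    by (simp add: multiple_jacobi_factor_def X_param_eq)
  hence "(\<Prod>j=1..r. multiple_jacobi_factor r n (\<lambda>j. a j * b) (c * d) j k) =
      (\<Prod>j=1..r. ?F j) * (\<Prod>j=1..r. ?X j * ?Y j) / ?q ^ (\<Sum>j=1..r. n j * ?K j)"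
    by (simp only: prod.distrib prod_dividef power_sum)
  also have "(\<Prod>j=1..r. ?X j * ?Y j) = qpoch (X_param q n a b c d r) q (k r) * (\<Prod>j=1..r-1. ?X j * ?Y j)"
  proof -
    have "{1..r} = insert r {1..r-1}" "r \<notin> {1..r-1}"
      using assms by auto
    moreover have "?K r = 0" by (simp add: tail_sum_def)
    ultimately show ?thesis by simp
  qed
  finally show ?thesis
    by (simp add: explicit_term_def poly_askey_wilson_basis power_int_minus)
qed

lemma poly_T_op_multiple_jacobi_poly:
  assumes "1 \<le> r"
  shows "poly (T_op q b c d (multiple_jacobi_poly r n (\<lambda>j. a j * b) (c * d))) (of_real (cos \<theta>)) =
    (\<Sum>k\<in>(\<Pi>\<^sub>E j\<in>{1..r}. {0..n j}). explicit_term q r n a b c d \<theta> k)"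
proof -
  let ?h = "\<lambda>m. poly (askey_wilson_basis q b m) (of_real (cos \<theta>)) / (qpoch (b * c) q m * qpoch (b * d) q m)"
  have "poly (T_op q b c d (multiple_jacobi_poly r n (\<lambda>j. a j * b) (c * d))) (of_real (cos \<theta>)) =
      (\<Sum>m\<le>\<Sum>j=1..r. n j. coeff (multiple_jacobi_poly r n (\<lambda>j. a j * b) (c * d)) m * ?h m)"
    unfolding T_op_bound[OF degree_multiple_jacobi_poly_le] by (simp add: poly_sum)
  also have "\<dots> = (\<Sum>k\<in>(\<Pi>\<^sub>E j\<in>{1..r}. {0..n j}). explicit_term q r n a b c d \<theta> k)"
    unfolding multiple_jacobi_poly_def explicit_term_eq[OF assms]
    by (intro sum_coeff_sum_monom finite_index_box tail_sum_le)
  finally show ?thesis .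
qed

end

section \<open>Shifting a parameter in the Askey--Wilson integral\<close>

text \<open>
  Cauchy's theorem for \<open>f(z) / z\<close> on an annulus: the two circles are homotopic along the radial
  segments.
\<close>

lemma integral_circle_radius_independent:
  fixes f :: "complex \<Rightarrow> complex"
  assumes "open S" "f holomorphic_on S" "0 \<notin> S" "0 < R\<^sub>1" "R\<^sub>1 \<le> R\<^sub>2"
    and annulus: "\<And>z. R\<^sub>1 \<le> norm z \<Longrightarrow> norm z \<le> R\<^sub>2 \<Longrightarrow> z \<in> S"
  shows "integral {-pi..pi} (\<lambda>t. f (of_real R\<^sub>1 * cis t)) =
         integral {-pi..pi} (\<lambda>t. f (of_real R\<^sub>2 * cis t))"
proof -
  let ?c = "\<lambda>R. part_circlepath 0 R (-pi) pi"
  have point: "?c R t = of_real R * cis (linepath (-pi) pi t)" for R t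
    by (simp add: part_circlepath_def cis_conv_exp linepath_def)
  have ends: "pathfinish (?c R) = pathstart (?c R)" for R
    unfolding pathfinish_def pathstart_def point by (simp add: linepath_def complex_eq_iff)
  have "homotopic_loops S (?c R\<^sub>1) (?c R\<^sub>2)"
  proof (rule homotopic_loops_linear)
    fix t :: real
    show "closed_segment (?c R\<^sub>1 t) (?c R\<^sub>2 t) \<subseteq> S"
    proof
      fix z assume "z \<in> closed_segment (?c R\<^sub>1 t) (?c R\<^sub>2 t)"
      then obtain u where u: "0 \<le> u" "u \<le> 1"
        and "z = (1 - u) *\<^sub>R ?c R\<^sub>1 t + u *\<^sub>R ?c R\<^sub>2 t"
        by (auto simp: closed_segment_def)
      hence "z = of_real ((1 - u) * R\<^sub>1 + u * R\<^sub>2) * cis (linepath (-pi) pi t)"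
        by (simp add: point scaleR_conv_of_real algebra_simps)
      moreover have "(1 - u) * R\<^sub>1 + u * R\<^sub>2 \<ge> R\<^sub>1" "(1 - u) * R\<^sub>1 + u * R\<^sub>2 \<le> R\<^sub>2"
        using u assms(5) mult_left_mono[of R\<^sub>1 R\<^sub>2 u] mult_left_mono[of R\<^sub>1 R\<^sub>2 "1 - u"]
        by (auto simp: algebra_simps)
      ultimately show "z \<in> S"
        using assms(4) by (intro annulus) (auto simp: norm_mult simp del: of_real_add of_real_mult)
    qed
  qed (simp_all only: path_part_circlepath ends)
  hence "contour_integral (?c R\<^sub>1) (\<lambda>z. f z / z) = contour_integral (?c R\<^sub>2) (\<lambda>z. f z / z)"
    using assms(1,2,3)
    by (intro Cauchy_theorem_homotopic_loops[of S])
       (auto intro!: holomorphic_intros)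
  moreover have "contour_integral (?c R) (\<lambda>z. f z / z) =
      \<i> * integral {-pi..pi} (\<lambda>t. f (of_real R * cis t))" if "R > 0" for R
  proof -
    have "contour_integral (?c R) (\<lambda>z. f z / z) =
        integral {-pi..pi} (\<lambda>t. \<i> * f (of_real R * cis t))"
      using that by (simp add: contour_integral_part_circlepath_eq mult_ac)
    thus ?thesis by simp
  qed
  ultimately show ?thesis
    using assms(4,5) by simp
qed

text \<open>
  This is what remains of the symmetrized kernel after the infinite products have been removed. With \<open>y = 1/z\<close> both sides
  contain the factor \<open>(z - y)\<^sup>2\<close>; one of these factors is split off in each term before the identity is expanded.
\<close>

lemma aw_shift_polynomial_identity:
  fixes z y a b c d :: complex
  assumes "z * y = 1"
  shows "- y * (1 - y ^ 2) * ((1 - a * z) * (1 - b * z) * (1 - c * z) * (1 - d * z))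
      - z * (1 - z ^ 2) * ((1 - a * y) * (1 - b * y) * (1 - c * y) * (1 - d * y)) =
      (a + b + c + d - (a*b*c + a*b*d + a*c*d + b*c*d) - (1 - a*b*c*d) * (z + y)) *
      ((1 - z ^ 2) * (1 - y ^ 2))"
proof -
  let ?P = "\<lambda>u. (1 - a * u) * (1 - b * u) * (1 - c * u) * (1 - d * u)"
  define M where "M = a + b + c + d - (a*b*c + a*b*d + a*c*d + b*c*d) - (1 - a*b*c*d) * (z + y)"
  have absorb: "y * (1 - p * z) = y - p" "z * (1 - p * y) = z - p" for p
    using assms by algebra+
  have "y ^ 2 * ?P z = (y * (1 - a * z)) * (y * (1 - b * z)) * (1 - c * z) * (1 - d * z)"
       "z ^ 2 * ?P y = (z * (1 - a * y)) * (z * (1 - b * y)) * (1 - c * y) * (1 - d * y)"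
    by (simp_all only: power2_eq_square mult_ac)
  \<comment> \<open>Two of the four factors in each product have absorbed a factor \<open>y\<close> or \<open>z\<close>, so this identity has low degree.\<close>
  hence "z ^ 2 * ?P y - y ^ 2 * ?P z = - M * (z - y)"
    unfolding absorb M_def using assms by algebra
  moreover have "y * (1 - y ^ 2) = (z - y) * y ^ 2" "z * (1 - z ^ 2) = - ((z - y) * z ^ 2)"
      "(1 - z ^ 2) * (1 - y ^ 2) = - ((z - y) * (z - y))"
    using assms by algebra+
  ultimately show ?thesis
    unfolding M_def[symmetric] by algebra
qed

context q_base
begin


text \<open>
  The finite products split off the first \<open>l\<close> factors of \<open>(a e\<^sup>i\<^sup>\<theta>, a e\<^sup>-\<^sup>i\<^sup>\<theta>; q)\<^sub>\<infinity>\<close> and the first \<open>m\<close> factors of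
  \<open>(b e\<^sup>i\<^sup>\<theta>, b e\<^sup>-\<^sup>i\<^sup>\<theta>; q)\<^sub>\<infinity>\<close> in the denominator of the weight.
\<close>

lemma askey_wilson_weight_shift:
  assumes "norm a < 1" "norm b < 1"
  shows "askey_wilson_weight q \<theta> (a * of_real q ^ l) (b * of_real q ^ m) c d =
    poly (askey_wilson_basis q a l) (of_real (cos \<theta>)) *
    poly (askey_wilson_basis q b m) (of_real (cos \<theta>)) * askey_wilson_weight q \<theta> a b c d"
proof -
  have split: "qpoch_inf (p * cis t) q =
      qpoch (p * cis t) q k * qpoch_inf (p * of_real q ^ k * cis t) q" for p t k
    using qpoch_inf_split[of "p * cis t" k] by (simp add: mult_ac)
  have nz: "qpoch (p * cis t) q k \<noteq> 0" if "norm p < 1" for p t k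
    using that by (intro qpoch_nonzero) (simp add: norm_mult)
  let ?s = "qpoch (a * cis \<theta>) q l * qpoch (a * cis (- \<theta>)) q l *
            (qpoch (b * cis \<theta>) q m * qpoch (b * cis (- \<theta>)) q m)"
  let ?N = "qpoch_inf (cis (2 * \<theta>)) q * qpoch_inf (cis (- (2 * \<theta>))) q"
  let ?D = "qpoch_inf (a * of_real q ^ l * cis \<theta>) q * qpoch_inf (a * of_real q ^ l * cis (- \<theta>)) q *
      (qpoch_inf (b * of_real q ^ m * cis \<theta>) q * qpoch_inf (b * of_real q ^ m * cis (- \<theta>)) q) *
      (qpoch_inf (c * cis \<theta>) q * qpoch_inf (c * cis (- \<theta>)) q) *
      (qpoch_inf (d * cis \<theta>) q * qpoch_inf (d * cis (- \<theta>)) q)"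
  have "askey_wilson_weight q \<theta> a b c d = ?N / (?s * ?D)"
    unfolding askey_wilson_weight_def split[of a \<theta> l] split[of a "-\<theta>" l]
      split[of b \<theta> m] split[of b "-\<theta>" m]
    by (simp only: mult_ac)
  moreover from nz assms have "?s \<noteq> 0"
    by simp
  hence "?N / ?D = ?s * (?N / (?s * ?D))"
    by (subst times_divide_eq_right, subst mult_divide_mult_cancel_left) (assumption, rule refl)
  ultimately show ?thesis
    by (simp only: askey_wilson_weight_def[of q \<theta> "a * of_real q ^ l"] poly_askey_wilson_basis)
qed

lemma continuous_on_askey_wilson_weight [continuous_intros]:
  assumes "norm a < 1" "norm b < 1" "norm c < 1" "norm d < 1"
  shows "continuous_on S (\<lambda>\<theta>. askey_wilson_weight q \<theta> a b c d)"
proof -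
  have "qpoch_inf (p * cis t) q \<noteq> 0" if "norm p < 1" for p t
    using that by (intro qpoch_inf_nonzero) (simp add: norm_mult)
  thus ?thesis
    unfolding askey_wilson_weight_def using assms
    by (intro continuous_intros) auto
qed

text \<open>
  Up to a constant this is \<open>F(q\<^sup>1\<^sup>/\<^sup>2 z)\<close>, where \<open>F(z)\<close> is the weight, with \<open>z = e\<^sup>i\<^sup>\<theta>\<close> and each of the four
  parameters multiplied by \<open>q\<^sup>1\<^sup>/\<^sup>2\<close>, divided by \<open>z - 1/z\<close>. The integral of the Askey--Wilson divided difference
  \<open>F(q\<^sup>1\<^sup>/\<^sup>2 z) - F(q\<^sup>-\<^sup>1\<^sup>/\<^sup>2 z)\<close> over the unit circle is \<open>0\<close>; in terms of the kernel,
  this is stated without square roots of \<open>q\<close>.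
\<close>

definition aw_shift_kernel ::
    "complex \<Rightarrow> complex \<Rightarrow> complex \<Rightarrow> complex \<Rightarrow> complex \<Rightarrow> complex" where
  "aw_shift_kernel a b c d z =
     - (qpoch_inf (of_real q * z ^ 2) q * qpoch_inf (inverse z ^ 2) q) /
     (z * (qpoch_inf (of_real q * (a * z)) q * qpoch_inf (a * inverse z) q *
      (qpoch_inf (of_real q * (b * z)) q * qpoch_inf (b * inverse z) q) *
      (qpoch_inf (of_real q * (c * z)) q * qpoch_inf (c * inverse z) q) *
      (qpoch_inf (of_real q * (d * z)) q * qpoch_inf (d * inverse z) q)))"

text \<open>
  In terms of \<open>F\<close> this is \<open>F(1/z) = - F(z)\<close>. In both values the infinite products agree up to
  one factor, and the quotient of these factors is \<open>-1\<close>.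
\<close>

lemma aw_shift_kernel_antisymmetric:
  assumes "norm z = 1" "norm a < 1" "norm b < 1" "norm c < 1" "norm d < 1"
  shows "aw_shift_kernel a b c d (z / of_real q) = - aw_shift_kernel a b c d (inverse z)"
proof -
  let ?q = "complex_of_real q"
  have z: "z \<noteq> 0" using assms by auto
  have 1: "qpoch_inf (?q * (z / ?q) ^ 2) q = (1 - z ^ 2 / ?q) * qpoch_inf (z ^ 2) q"
    using qpoch_inf_unfold[of "z ^ 2 / ?q"] by (simp add: power2_eq_square)
  have 2: "qpoch_inf (?q * inverse z ^ 2) q = (1 - ?q / z ^ 2) * qpoch_inf (inverse (z / ?q) ^ 2) q"
  proof -
    have "?q * inverse z ^ 2 = ?q / z ^ 2" "inverse (z / ?q) ^ 2 = ?q / z ^ 2 * ?q"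
      by (simp_all add: power2_eq_square divide_inverse)
    thus ?thesis
      using qpoch_inf_unfold[of "?q / z ^ 2"] by simp
  qed
  have 3: "?q * (p * (z / ?q)) = p * inverse (inverse z)" "p * inverse (z / ?q) = ?q * (p * inverse z)" for p
    by (simp_all add: divide_inverse)
  have 4: "(1 - z ^ 2 / ?q) / (z / ?q) = - ((1 - ?q / z ^ 2) / inverse z)"
  proof -
    have "(1 - z ^ 2 / ?q) / (z / ?q) = (?q - z ^ 2) / z"
      by (simp add: left_diff_distrib diff_divide_distrib)
    moreover have "(1 - ?q / z ^ 2) / inverse z = (z ^ 2 - ?q) / z"
      using z by (simp add: field_simps power2_eq_square)
    ultimately show ?thesis
      by (metis minus_diff_eq minus_divide_left)
  qed
  define D where "D = qpoch_inf (?q * (a * inverse z)) q * qpoch_inf (a * inverse (inverse z)) q *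
      (qpoch_inf (?q * (b * inverse z)) q * qpoch_inf (b * inverse (inverse z)) q) *
      (qpoch_inf (?q * (c * inverse z)) q * qpoch_inf (c * inverse (inverse z)) q) *
      (qpoch_inf (?q * (d * inverse z)) q * qpoch_inf (d * inverse (inverse z)) q)"
  let ?E = "qpoch_inf (z ^ 2) q * qpoch_inf (inverse (z / ?q) ^ 2) q / D"
  have "aw_shift_kernel a b c d (z / ?q) = - ((1 - z ^ 2 / ?q) / (z / ?q)) * ?E"
    unfolding aw_shift_kernel_def 1 3 D_def by (simp add: mult_ac)
  also have "\<dots> = ((1 - ?q / z ^ 2) / inverse z) * ?E"
    unfolding 4 by simp
  also have "\<dots> = - aw_shift_kernel a b c d (inverse z)"
    unfolding aw_shift_kernel_def 2 D_def by (simp add: mult_ac)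
  finally show ?thesis .
qed

text \<open>
  The poles of the kernel satisfy \<open>\<bar>z\<bar> \<le> \<bar>p\<bar>\<close> or \<open>\<bar>q p z\<bar> \<ge> 1\<close> for one of the parameters \<open>p\<close>. The annulus
  between contains the circles of radius \<open>1\<close> and \<open>1/q\<close>.
\<close>

definition aw_annulus :: "complex \<Rightarrow> complex \<Rightarrow> complex \<Rightarrow> complex \<Rightarrow> complex set" where
  "aw_annulus a b c d =
     (\<Inter>p\<in>{a,b,c,d}. {z. norm p < norm z} \<inter> {z. norm (of_real q * (p * z)) < 1})"

lemma open_aw_annulus: "open (aw_annulus a b c d)"
  unfolding aw_annulus_def
  by (intro open_INT open_Int ballI open_Collect_less continuous_intros) auto

lemma zero_notin_aw_annulus: "0 \<notin> aw_annulus a b c d"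
  by (simp add: aw_annulus_def)

lemma in_aw_annulusI:
  assumes "norm a < 1" "norm b < 1" "norm c < 1" "norm d < 1" "1 \<le> norm z" "norm z \<le> 1 / q"
  shows "z \<in> aw_annulus a b c d"
proof -
  have "norm p < norm z \<and> norm (of_real q * (p * z)) < 1" if "norm p < 1" for p
  proof
    show "norm p < norm z" using that \<open>1 \<le> norm z\<close> by simp
    have "q * norm z \<le> 1" using \<open>norm z \<le> 1 / q\<close> q_pos by (simp add: field_simps)
    hence "norm p * (q * norm z) \<le> norm p" by (intro mult_left_le) auto
    thus "norm (of_real q * (p * z)) < 1" using that q_pos by (simp add: norm_mult mult_ac)
  qed
  thus ?thesis using assms by (auto simp: aw_annulus_def)
qed

lemma holomorphic_aw_shift_kernel: "aw_shift_kernel a b c d holomorphic_on aw_annulus a b c d"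
proof -
  have nz: "qpoch_inf (of_real q * (p * z)) q \<noteq> 0" "qpoch_inf (p * inverse z) q \<noteq> 0"
    if "p \<in> {a,b,c,d}" "z \<in> aw_annulus a b c d" for p z
  proof -
    have "norm p < norm z" "norm (of_real q * (p * z)) < 1"
      using that by (auto simp: aw_annulus_def)
    moreover from this have "norm (p * inverse z) < 1"
      using norm_ge_zero[of p] by (simp add: norm_divide divide_less_eq_1 flip: divide_inverse)
    ultimately show "qpoch_inf (of_real q * (p * z)) q \<noteq> 0" "qpoch_inf (p * inverse z) q \<noteq> 0"
      by (simp_all add: qpoch_inf_nonzero)
  qed
  show ?thesis
    unfolding aw_shift_kernel_def
    using zero_notin_aw_annulus by (intro holomorphic_intros) (auto simp: nz)
qed

text \<open>
  The integrals over the circles of radius \<open>1\<close> and \<open>1/q\<close> agree by Cauchy's theorem. By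
  antisymmetry, the second is the negative of the integral over the unit circle traversed backwards, so both vanish.
\<close>

lemma integral_aw_shift_kernel:
  assumes "norm a < 1" "norm b < 1" "norm c < 1" "norm d < 1"
  shows "integral {-pi..pi} (\<lambda>t. aw_shift_kernel a b c d (cis t)) = 0"
proof -
  let ?G = "aw_shift_kernel a b c d"
  have "integral {-pi..pi} (\<lambda>t. ?G (of_real 1 * cis t)) =
        integral {-pi..pi} (\<lambda>t. ?G (of_real (1 / q) * cis t))"
    using q_pos q_less_1
    by (intro integral_circle_radius_independent[of "aw_annulus a b c d"] open_aw_annulus
          holomorphic_aw_shift_kernel zero_notin_aw_annulus in_aw_annulusI assms) auto
  also have "\<dots> = integral {-pi..pi} (\<lambda>t. - ?G (cis (- t)))"
    using aw_shift_kernel_antisymmetric[OF _ assms] by (simp add: cis_inverse mult.commute divide_inverse)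
  also have "\<dots> = - integral {-pi..pi} (\<lambda>t. ?G (cis t))"
    using Henstock_Kurzweil_Integration.integral_reflect_real[of pi "-pi" "\<lambda>t. ?G (cis t)"] by simp
  finally show ?thesis by simp
qed

text \<open>
  On the unit circle the kernel is the weight times \<open>(1 - a z) (1 - b z) (1 - c z) (1 - d z)\<close> divided by
  \<open>z (z\<^sup>2 - 1)\<close>. Adding its values at \<open>z\<close> and \<open>1/z\<close> cancels the denominator and leaves a polynomial of degree one in
  \<open>cos \<theta>\<close>.
\<close>

lemma aw_shift_kernel_symmetrized:
  assumes "norm a < 1" "norm b < 1" "norm c < 1" "norm d < 1"
  shows "aw_shift_kernel a b c d (cis \<theta>) + aw_shift_kernel a b c d (cis (- \<theta>)) =
    (a + b + c + d - (a*b*c + a*b*d + a*c*d + b*c*d) - (1 - a*b*c*d) * (2 * of_real (cos \<theta>))) *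
    askey_wilson_weight q \<theta> a b c d"
proof -
  define z y where "z = cis \<theta>" and "y = cis (- \<theta>)"
  have zy: "z * y = 1" "inverse z = y" "inverse y = z" "z \<noteq> 0" "y \<noteq> 0"
    by (simp_all add: z_def y_def cis_mult cis_inverse)
  have nrm: "norm z = 1" "norm y = 1" by (simp_all add: z_def y_def)
  let ?q = "complex_of_real q"
  have sq: "cis (2 * \<theta>) = z ^ 2" "cis (- (2 * \<theta>)) = y ^ 2"
    by (simp_all add: z_def y_def power2_eq_square cis_mult)
  define E where "E = qpoch_inf (?q * z ^ 2) q * qpoch_inf (?q * y ^ 2) q /
     (qpoch_inf (a * z) q * qpoch_inf (a * y) q *
      (qpoch_inf (b * z) q * qpoch_inf (b * y) q) *
      (qpoch_inf (c * z) q * qpoch_inf (c * y) q) *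
      (qpoch_inf (d * z) q * qpoch_inf (d * y) q))"
  have unf: "qpoch_inf (u ^ 2) q = (1 - u ^ 2) * qpoch_inf (?q * u ^ 2) q" for u
    using qpoch_inf_unfold[of "u ^ 2"] by (simp add: mult_ac)
  have W: "askey_wilson_weight q \<theta> a b c d = (1 - z ^ 2) * (1 - y ^ 2) * E"
    unfolding askey_wilson_weight_def sq E_def unf[of z] unf[of y]
    by (simp add: z_def y_def mult_ac)
  have inv: "1 / qpoch_inf (?q * (p * u)) q = (1 - p * u) / qpoch_inf (p * u) q"
    if "norm p < 1" "norm u = 1" for p u
  proof -
    have "norm (p * u) < 1" using that by (simp add: norm_mult)
    hence "1 - p * u \<noteq> 0" by (rule one_minus_nonzero)
    thus ?thesis using qpoch_inf_unfold[of "p * u"] by (simp add: mult_ac)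
  qed
  have G: "aw_shift_kernel a b c d u =
      - v * (1 - v ^ 2) * ((1 - a * u) * (1 - b * u) * (1 - c * u) * (1 - d * u)) *
      (qpoch_inf (?q * u ^ 2) q * qpoch_inf (?q * v ^ 2) q /
     (qpoch_inf (a * u) q * qpoch_inf (a * v) q *
      (qpoch_inf (b * u) q * qpoch_inf (b * v) q) *
      (qpoch_inf (c * u) q * qpoch_inf (c * v) q) *
      (qpoch_inf (d * u) q * qpoch_inf (d * v) q)))"
    if "inverse u = v" "norm u = 1" for u v
  proof -
    have "aw_shift_kernel a b c d u = - inverse u * (1 - v ^ 2) *
      (qpoch_inf (?q * u ^ 2) q * qpoch_inf (?q * v ^ 2) q) *
      (1 / qpoch_inf (?q * (a * u)) q * (1 / qpoch_inf (?q * (b * u)) q) *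
       (1 / qpoch_inf (?q * (c * u)) q) * (1 / qpoch_inf (?q * (d * u)) q)) /
      (qpoch_inf (a * v) q * qpoch_inf (b * v) q * qpoch_inf (c * v) q * qpoch_inf (d * v) q)"
      unfolding aw_shift_kernel_def that(1) unf[of v]
      by (simp add: divide_inverse mult_ac that(1))
    thus ?thesis
      unfolding inv[OF assms(1) that(2)] inv[OF assms(2) that(2)]
        inv[OF assms(3) that(2)] inv[OF assms(4) that(2)] that(1)
      by (simp add: divide_inverse mult_ac)
  qed
  have Gz: "aw_shift_kernel a b c d z =
      - y * (1 - y ^ 2) * ((1 - a * z) * (1 - b * z) * (1 - c * z) * (1 - d * z)) * E"
    using G[OF zy(2) nrm(1)] by (simp add: E_def mult_ac)
  have Gy: "aw_shift_kernel a b c d y =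
      - z * (1 - z ^ 2) * ((1 - a * y) * (1 - b * y) * (1 - c * y) * (1 - d * y)) * E"
    using G[OF zy(3) nrm(2)] by (simp add: E_def mult_ac)
  note poly_identity = aw_shift_polynomial_identity[OF zy(1), of a b c d]
  have "aw_shift_kernel a b c d z + aw_shift_kernel a b c d y =
      (- y * (1 - y ^ 2) * ((1 - a * z) * (1 - b * z) * (1 - c * z) * (1 - d * z))
      - z * (1 - z ^ 2) * ((1 - a * y) * (1 - b * y) * (1 - c * y) * (1 - d * y))) * E"
    unfolding Gz Gy by (simp add: left_diff_distrib)
  also have "\<dots> =
    (a + b + c + d - (a*b*c + a*b*d + a*c*d + b*c*d) - (1 - a*b*c*d) * (z + y)) * askey_wilson_weight q \<theta> a b c d"
    unfolding poly_identity W by (simp only: mult.assoc)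
  finally show ?thesis
    by (simp add: cos_conv_cis z_def y_def)
qed

text \<open>
  Folding the circle onto its upper half replaces the kernel by its symmetrization.
\<close>

lemma has_integral_askey_wilson_first_moment:
  assumes "norm a < 1" "norm b < 1" "norm c < 1" "norm d < 1"
  shows "((\<lambda>\<theta>. (a + b + c + d - (a*b*c + a*b*d + a*c*d + b*c*d)
            - (1 - a*b*c*d) * (2 * of_real (cos \<theta>))) *
          askey_wilson_weight q \<theta> a b c d) has_integral 0) {0..pi}"
proof -
  let ?g = "\<lambda>t. aw_shift_kernel a b c d (cis t)"
  have cont: "continuous_on A ?g" for A
    using q_pos q_less_1
    by (intro continuous_on_compose2[OF holomorphic_on_imp_continuous_on[OF holomorphic_aw_shift_kernel]]
          continuous_intros) (auto intro!: in_aw_annulusI assms)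
  have int: "?g integrable_on {x..y}" for x y
    by (intro integrable_continuous_real cont)
  have "((\<lambda>t. ?g (- t)) has_integral integral {-pi..0} ?g) {0..pi}"
    using has_integral_reflect_lemma_real[OF integrable_integral[OF int[of "-pi" 0]]]
    by (simp only: minus_zero minus_minus)
  from has_integral_add[OF integrable_integral[OF int[of 0 pi]] this]
  have sum: "((\<lambda>t. ?g t + ?g (- t)) has_integral (integral {0..pi} ?g + integral {-pi..0} ?g)) {0..pi}" .
  have "integral {0..pi} ?g + integral {-pi..0} ?g = integral {-pi..pi} ?g"
    using Henstock_Kurzweil_Integration.integral_combine[OF _ _ int[of "-pi" pi], of 0]
    by (simp only: add.commute) simp
  also have "\<dots> = 0"
    by (rule integral_aw_shift_kernel[OF assms])
  finally show ?thesis
    using sum aw_shift_kernel_symmetrized[OF assms] by (simp only:)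
qed

definition aw_integral :: "complex \<Rightarrow> complex \<Rightarrow> complex \<Rightarrow> complex \<Rightarrow> complex" where
  "aw_integral a b c d = integral {0..pi} (\<lambda>\<theta>. askey_wilson_weight q \<theta> a b c d)"

lemma has_integral_askey_wilson_weight:
  assumes "norm a < 1" "norm b < 1" "norm c < 1" "norm d < 1"
  shows "((\<lambda>\<theta>. askey_wilson_weight q \<theta> a b c d) has_integral aw_integral a b c d) {0..pi}"
  unfolding aw_integral_def
  by (intro integrable_integral integrable_continuous_real continuous_intros assms)

text \<open>
  The new weight is \<open>1 + b\<^sup>2 - 2 b cos \<theta>\<close> times the old one, and the first-moment identity
  determines the integral of \<open>cos \<theta>\<close> against the old weight.
\<close>

lemma aw_integral_contiguous:
  assumes "norm a < 1" "norm b < 1" "norm c < 1" "norm d < 1"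
  shows "(1 - a*b*c*d) * aw_integral a (b * of_real q) c d =
         (1 - a*b) * (1 - b*c) * (1 - b*d) * aw_integral a b c d"
proof -
  have "((\<lambda>\<theta>. b * ((a + b + c + d - (a*b*c + a*b*d + a*c*d + b*c*d)
            - (1 - a*b*c*d) * (2 * of_real (cos \<theta>))) * askey_wilson_weight q \<theta> a b c d) +
          (1 - a*b) * (1 - b*c) * (1 - b*d) * askey_wilson_weight q \<theta> a b c d)
        has_integral (b * 0 + (1 - a*b) * (1 - b*c) * (1 - b*d) * aw_integral a b c d)) {0..pi}"
    by (intro has_integral_add has_integral_mult_right has_integral_askey_wilson_weight
          has_integral_askey_wilson_first_moment assms)
  also have "(\<lambda>\<theta>. b * ((a + b + c + d - (a*b*c + a*b*d + a*c*d + b*c*d)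
            - (1 - a*b*c*d) * (2 * of_real (cos \<theta>))) * askey_wilson_weight q \<theta> a b c d) +
          (1 - a*b) * (1 - b*c) * (1 - b*d) * askey_wilson_weight q \<theta> a b c d) =
      (\<lambda>\<theta>. (1 - a*b*c*d) * askey_wilson_weight q \<theta> a (b * of_real q) c d)" (is "?f = _")
  proof
    fix \<theta>
    have shifted: "askey_wilson_weight q \<theta> a (b * of_real q) c d =
        (1 + b ^ 2 - b * (2 * of_real (cos \<theta>))) * askey_wilson_weight q \<theta> a b c d"
      using askey_wilson_weight_shift[OF assms(1,2), of \<theta> 0 1 c d]
      by (simp add: askey_wilson_basis_def mult_ac)
    show "?f \<theta> = (1 - a*b*c*d) * askey_wilson_weight q \<theta> a (b * of_real q) c d"
      unfolding shifted by (simp add: algebra_simps power2_eq_square)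
  qed
  finally have "((\<lambda>\<theta>. (1 - a*b*c*d) * askey_wilson_weight q \<theta> a (b * of_real q) c d)
      has_integral ((1 - a*b) * (1 - b*c) * (1 - b*d) * aw_integral a b c d)) {0..pi}" by simp
  moreover have "((\<lambda>\<theta>. (1 - a*b*c*d) * askey_wilson_weight q \<theta> a (b * of_real q) c d)
      has_integral ((1 - a*b*c*d) * aw_integral a (b * of_real q) c d)) {0..pi}"
    using norm_mult_q_power_less_1[OF assms(2), of 1]
    by (intro has_integral_mult_right has_integral_askey_wilson_weight assms) simp
  ultimately show ?thesis
    by (rule has_integral_unique[symmetric])
qed

lemma aw_integral_shift:
  assumes "norm a < 1" "norm b < 1" "norm c < 1" "norm d < 1"
  shows "qpoch (c*d * (a*b)) q m * aw_integral a (b * of_real q ^ m) c d =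
         qpoch (a*b) q m * qpoch (b*c) q m * qpoch (b*d) q m * aw_integral a b c d"
proof (induction m)
  case (Suc m)
  have "qpoch (c*d * (a*b)) q (Suc m) * aw_integral a (b * of_real q ^ Suc m) c d =
      qpoch (c*d * (a*b)) q m * ((1 - a * (b * of_real q ^ m) * c * d) *
        aw_integral a (b * of_real q ^ m * of_real q) c d)"
    by (simp add: qpoch_Suc mult_ac)
  also have "\<dots> = (1 - a * (b * of_real q ^ m)) * (1 - b * of_real q ^ m * c) *
      (1 - b * of_real q ^ m * d) * (qpoch (c*d * (a*b)) q m * aw_integral a (b * of_real q ^ m) c d)"
    using aw_integral_contiguous[OF assms(1) norm_mult_q_power_less_1[OF assms(2), of m] assms(3,4)]
    by (simp add: mult_ac)
  also have "\<dots> = qpoch (a*b) q (Suc m) * qpoch (b*c) q (Suc m) * qpoch (b*d) q (Suc m) *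
      aw_integral a b c d"
    unfolding Suc.IH by (simp add: qpoch_Suc mult_ac)
  finally show ?case .
qed simp

end

section \<open>Transfer of orthogonality\<close>

context q_base
begin

text \<open>
  Both basis polynomials are absorbed into the weight, which becomes the weight with \<open>a q\<^sup>l\<close> and \<open>b q\<^sup>k\<close>. Its
  mass contains \<open>(b c)\<^sub>k (b d)\<^sub>k\<close>, which cancels against the denominators of \<open>T\<close>, and the
  remaining ratio is the one in the ratio transform at \<open>y = a b q\<^sup>l\<close>.
\<close>

lemma has_integral_T_op_basis:
  assumes "norm a < 1" "norm b < 1" "norm c < 1" "norm d < 1"
    and "ratio_transform (c * d) p (a * b * of_real q ^ l) = 0"
  shows "((\<lambda>\<theta>. poly (T_op q b c d p) (of_real (cos \<theta>)) *
            poly (askey_wilson_basis q a l) (of_real (cos \<theta>)) * askey_wilson_weight q \<theta> a b c d)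
          has_integral 0) {0..pi}"
proof -
  let ?q = "complex_of_real q"
  let ?a = "a * ?q ^ l" and ?y = "a * b * ?q ^ l"
  let ?g = "\<lambda>k. coeff p k / (qpoch (b * c) q k * qpoch (b * d) q k)"
  have a: "norm ?a < 1" by (rule norm_mult_q_power_less_1[OF assms(1)])
  have y: "?a * b = ?y" by simp
  have nz: "qpoch (b * c) q k \<noteq> 0" "qpoch (b * d) q k \<noteq> 0" "qpoch (c * d * ?y) q k \<noteq> 0" for k
    using norm_mult_q_power_less_1[OF norm_mult_less_1[OF assms(1,2)]]
    by (auto intro!: qpoch_nonzero norm_mult_less_1[of c d] norm_mult_less_1[of b]
          norm_mult_less_1[of "c * d"] assms)
  have "((\<lambda>\<theta>. \<Sum>k\<le>degree p. ?g k * askey_wilson_weight q \<theta> ?a (b * ?q ^ k) c d)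
      has_integral (\<Sum>k\<le>degree p. ?g k * aw_integral ?a (b * ?q ^ k) c d)) {0..pi}"
    by (intro has_integral_sum has_integral_mult_right has_integral_askey_wilson_weight
          norm_mult_q_power_less_1 assms(1-4)) auto
  moreover have "(\<Sum>k\<le>degree p. ?g k * askey_wilson_weight q \<theta> ?a (b * ?q ^ k) c d) =
      poly (T_op q b c d p) (of_real (cos \<theta>)) *
      poly (askey_wilson_basis q a l) (of_real (cos \<theta>)) * askey_wilson_weight q \<theta> a b c d" for \<theta>
    by (simp add: askey_wilson_weight_shift[OF assms(1,2)] T_op_def poly_sum sum_distrib_left sum_distrib_right mult_ac)
  moreover have "(\<Sum>k\<le>degree p. ?g k * aw_integral ?a (b * ?q ^ k) c d) =
      aw_integral ?a b c d * ratio_transform (c * d) p ?y"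
  proof -
    have "?g k * aw_integral ?a (b * ?q ^ k) c d =
        aw_integral ?a b c d * (coeff p k * (qpoch ?y q k / qpoch (c * d * ?y) q k))" for k
    proof -
      have "aw_integral ?a (b * ?q ^ k) c d =
          qpoch ?y q k * qpoch (b * c) q k * qpoch (b * d) q k * aw_integral ?a b c d / qpoch (c * d * ?y) q k"
        using aw_integral_shift[OF a assms(2-4), of k] nz(3)[of k]
        unfolding y by (metis nonzero_mult_div_cancel_left)
      thus ?thesis using nz(1,2)[of k] by simp
    qed
    thus ?thesis
      by (simp add: ratio_transform_def sum_distrib_left)
  qed
  ultimately show ?thesis using assms(5) by simp
qed

text \<open>
  Orthogonality to the basis polynomials gives orthogonality to the powers of \<open>x\<close>: the recurrence
  \<open>2 a q\<^sup>m x e\<^sub>m = (1 + a\<^sup>2 q\<^sup>2\<^sup>m) e\<^sub>m - e\<^sub>m\<^sub>+\<^sub>1\<close> trades a power of \<open>x\<close> for an index shift, and this needs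
  \<open>a \<noteq> 0\<close>. The hypothesis with \<open>l + m\<close> keeps all indices in range.
\<close>

lemma has_integral_power_mult_basis:
  assumes "a \<noteq> 0"
    and basis: "\<And>m. m < N \<Longrightarrow>
      ((\<lambda>\<theta>. f \<theta> * poly (askey_wilson_basis q a m) (of_real (cos \<theta>))) has_integral 0) S"
    and "l + m < N"
  shows "((\<lambda>\<theta>. f \<theta> * of_real (cos \<theta>) ^ l * poly (askey_wilson_basis q a m) (of_real (cos \<theta>)))
           has_integral 0) S"
  using assms(3)
proof (induction l arbitrary: m)
  case 0
  thus ?case using basis by simp
next
  case (Suc l)
  let ?e = "\<lambda>m \<theta>. poly (askey_wilson_basis q a m) (of_real (cos \<theta>))"
  let ?c = "2 * a * complex_of_real q ^ m" and ?s = "1 + a ^ 2 * of_real q ^ (2 * m)"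
  have c: "?c \<noteq> 0" using assms(1) by simp
  have "((\<lambda>\<theta>. ?s / ?c * (f \<theta> * of_real (cos \<theta>) ^ l * ?e m \<theta>) -
      1 / ?c * (f \<theta> * of_real (cos \<theta>) ^ l * ?e (Suc m) \<theta>)) has_integral (?s / ?c * 0 - 1 / ?c * 0)) S"
    using Suc.prems by (intro has_integral_diff has_integral_mult_right Suc.IH) auto
  moreover have "?s / ?c * (f \<theta> * of_real (cos \<theta>) ^ l * ?e m \<theta>) -
      1 / ?c * (f \<theta> * of_real (cos \<theta>) ^ l * ?e (Suc m) \<theta>) =
      f \<theta> * of_real (cos \<theta>) ^ Suc l * ?e m \<theta>" for \<theta>
  proof -
    have step: "?e (Suc m) \<theta> = (?s - ?c * of_real (cos \<theta>)) * ?e m \<theta>"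
      by (simp add: askey_wilson_basis_def algebra_simps)
    have "s / c * (X * E) - 1 / c * (X * ((s - c * x) * E)) = X * x * E" if "c \<noteq> 0"
      for s c X E x :: complex
      using that by (simp add: field_simps)
    from this[OF c, where s = ?s and X = "f \<theta> * of_real (cos \<theta>) ^ l" and E = "?e m \<theta>"
        and x = "of_real (cos \<theta>)"]
    show ?thesis
      unfolding step by (simp only: power_Suc2 mult.assoc)
  qed
  ultimately show ?case by simp
qed

end

text \<open>
  The substitution \<open>x = cos \<theta>\<close>. Its derivative is infinite at \<open>x = 1\<close> and \<open>x = -1\<close>, so a version of the substitution rule
  with finitely many exceptional points is used.
\<close>

lemma has_integral_arccos_substitution:
  fixes f :: "real \<Rightarrow> complex"
  assumes "continuous_on {0..pi} f" "(f has_integral I) {0..pi}"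
  shows "((\<lambda>x. f (arccos x) / of_real (sqrt (1 - x ^ 2))) has_integral I) {-1..1}"
proof -
  have "((\<lambda>x. - inverse (sqrt (1 - x ^ 2)) *\<^sub>R f (arccos x)) has_integral
      (integral {arccos (-1)..arccos 1} f - integral {arccos 1..arccos (-1)} f)) {-1..1}"
  proof (rule has_integral_substitution_general[where s = "{-1, 1}"])
    show "arccos ` {-1..1} \<subseteq> {0..pi}"
      using arccos_lbound arccos_ubound by auto
    show "continuous_on {-1..1} arccos"
      by (rule continuous_on_arccos')
    show "(arccos has_field_derivative - inverse (sqrt (1 - x ^ 2))) (at x within {-1..1})"
      if "x \<in> {-1..1} - {-1, 1}" for x :: real
      using that DERIV_arccos[of x] by (auto intro: has_field_derivative_at_within simp: inverse_minus_eq)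
  qed (use assms in auto)
  moreover have "integral {0..pi} f = I"
    using assms(2) by (rule integral_unique)
  ultimately have "((\<lambda>x. - inverse (sqrt (1 - x ^ 2)) *\<^sub>R f (arccos x)) has_integral - I) {-1..1}"
    by simp
  from has_integral_neg[OF this] show ?thesis
    by (simp add: scaleR_conv_of_real divide_inverse mult.commute)
qed

theorem theorem3p5:
  fixes q :: real and r :: nat and n :: "nat \<Rightarrow> nat"
    and a :: "nat \<Rightarrow> complex" and b c d :: complex
  assumes "0 < q" and "q < 1" and "1 \<le> r"
    and "\<And>j. j \<in> {1..r} \<Longrightarrow> norm (a j) < 1"
    and "norm b < 1" and "norm c < 1" and "norm d < 1"
    and "b \<noteq> 0"
    and "\<And>j. j \<in> {1..r} \<Longrightarrow> a j \<noteq> 0"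
    and "\<And>i j m. i \<in> {1..r} \<Longrightarrow> j \<in> {1..r} \<Longrightarrow> i \<noteq> j \<Longrightarrow>
           a i / a j \<noteq> of_real q powi (m :: int)"
  defines "p \<equiv> T_op q b c d
             (multiple_little_q_jacobi q r n (\<lambda>j. a j * b / of_real q) (c * d / of_real q))"
  shows "is_multiple_askey_wilson q r n a b c d p \<and>
         (\<forall>\<theta> :: real. poly p (of_real (cos \<theta>)) =
            (\<Sum>k\<in>(\<Pi>\<^sub>E j\<in>{1..r}. {0..n j}). explicit_term q r n a b c d \<theta> k))"
proof -
  interpret q_base q
    by unfold_locales (fact assms)+
  let ?t = "\<lambda>j. a j * b" and ?\<beta> = "c * d"
  let ?m = "multiple_jacobi_poly r n ?t ?\<beta>"
  have \<beta>: "norm ?\<beta> < 1" by (intro norm_mult_less_1 assms)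
  have t: "norm (?t j) < 1" if "j \<in> {1..r}" for j
    by (intro norm_mult_less_1 assms that)
  have "?t j \<noteq> 0" if "j \<in> {1..r}" for j
    using assms(8) assms(9)[OF that] by simp
  moreover have "?t i / ?t j \<noteq> of_real q powi m"
    if "i \<in> {1..r}" "j \<in> {1..r}" "i \<noteq> j" for i j and m :: int
    using assms(10)[OF that] assms(8) by simp
  ultimately have "degree ?m = (\<Sum>j=1..r. n j) \<and>
      multiple_little_q_jacobi q r n (\<lambda>j. a j * b / of_real q) (?\<beta> / of_real q) = ?m"
    using multiple_little_q_jacobi_explicit[of ?\<beta> r ?t n] \<beta> t assms(3) by blast
  hence deg: "degree ?m = (\<Sum>j=1..r. n j)" and p: "p = T_op q b c d ?m"
    by (simp_all add: p_def)
  have "?m \<noteq> 0"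
    using poly_multiple_jacobi_poly_0[of r n ?t ?\<beta>] by auto
  note T = degree_T_op[OF assms(5-8) this, folded p]
  have "((\<lambda>x. poly p (of_real x) * of_real x ^ l *
      askey_wilson_weight q (arccos x) (a j) b c d / of_real (sqrt (1 - x ^ 2))) has_integral 0) {-1..1}"
    if j: "j \<in> {1..r}" and l: "l < n j" for j l
  proof -
    let ?w = "\<lambda>\<theta>. askey_wilson_weight q \<theta> (a j) b c d"
    let ?f = "\<lambda>\<theta>. poly p (of_real (cos \<theta>)) * of_real (cos \<theta>) ^ l * ?w \<theta>"
    note aj = assms(4)[OF j]
    have "((\<lambda>\<theta>. poly p (of_real (cos \<theta>)) * ?w \<theta> * poly (askey_wilson_basis q (a j) m) (of_real (cos \<theta>)))
        has_integral 0) {0..pi}" if "m < n j" for m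
    proof -
      have "?t j * of_real q ^ m \<in> jacobi_nodes r n ?t"
        using j that by (force simp: jacobi_nodes_def)
      hence "ratio_transform ?\<beta> ?m (?t j * of_real q ^ m) = 0"
        by (intro ratio_transform_multiple_jacobi_poly_node \<beta> t assms(3))
      from has_integral_T_op_basis[OF aj assms(5-7) this] show ?thesis
        by (simp add: p mult_ac)
    qed
    from has_integral_power_mult_basis[OF assms(9)[OF j] this, of "n j" l 0] l
    have "(?f has_integral 0) {0..pi}"
      by (simp add: askey_wilson_basis_def mult_ac)
    moreover have "continuous_on {0..pi} ?f"
      by (intro continuous_intros aj assms(5-7))
    ultimately have "((\<lambda>x. ?f (arccos x) / of_real (sqrt (1 - x ^ 2))) has_integral 0) {-1..1}"
      by (intro has_integral_arccos_substitution)
    thus ?thesis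
      by (rule has_integral_eq[rotated]) (simp add: cos_arccos)
  qed
  thus ?thesis
    using T deg poly_T_op_multiple_jacobi_poly[OF assms(3), of b c d n a]
    unfolding is_multiple_askey_wilson_def p by simp
qed

end
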